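(* Let $\mathcal{A}$ be a locally finite family of at least two distinct lines in the plane with no ordinary vertex. Then exactly one of the following holds: (i) the lines of $\mathcal{A}$ are all parallel; (ii) the lines of $\mathcal{A}$ all pass through one point; (iii) some affine map of the plane takes $\mathcal{A}$ onto the triangular arrangement $$\mathcal{A}_\triangle=\{x=m\}\cup\{y=n\}\cup\{x+y=k\},\qquad m,n,k\in\mathbb{Z}.$$ Conversely, each of (i)–(iii) has no ordinary vertex. In case (iii) every vertex of $\mathcal{A}$ lies on exactly three lines and every face of $\mathcal{A}$ is a triangle.
   Context: A family of distinct lines in the plane is locally finite if every disc meets finitely many lines of the family. A vertex of $\mathcal{A}$ is a point lying on at least two of its lines; an ordinary vertex lies on exactly two. The faces of $\mathcal{A}$ are the connected components of the complement of $\bigcup\mathcal{A}$, which are open convex polygonal regions.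
   Formalization: In the converse for case (ii), families of exactly two lines are excluded, since two crossing lines pass through one point that is an ordinary vertex. *)

theory Defs
  imports "HOL-Analysis.Analysis"
begin

text \<open>A family of distinct lines is a set of lines.\<close>

definition is_line :: "(real^2) set \<Rightarrow> bool" where
  "is_line l \<longleftrightarrow> affine l \<and> aff_dim l = 1"

definition locally_finite_lines :: "(real^2) set set \<Rightarrow> bool" where
  "locally_finite_lines \<A> \<longleftrightarrow> (\<forall>c r. finite {l \<in> \<A>. l \<inter> cball c r \<noteq> {}})"

definition lines_through :: "(real^2) set set \<Rightarrow> real^2 \<Rightarrow> (real^2) set set" where
  "lines_through \<A> p = {l \<in> \<A>. p \<in> l}"

definition is_vertex :: "(real^2) set set \<Rightarrow> real^2 \<Rightarrow> bool" where
  "is_vertex \<A> p \<longleftrightarrow> (\<exists>l\<in>lines_through \<A> p. \<exists>m\<in>lines_through \<A> p. l \<noteq> m)"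

definition ordinary_vertex :: "(real^2) set set \<Rightarrow> real^2 \<Rightarrow> bool" where
  "ordinary_vertex \<A> p \<longleftrightarrow> is_vertex \<A> p \<and> card (lines_through \<A> p) = 2"

definition arrangement_faces :: "(real^2) set set \<Rightarrow> (real^2) set set" where
  "arrangement_faces \<A> = components (- \<Union>\<A>)"

text \<open>Faces are open sets, so a triangular face is an open nondegenerate triangle.\<close>

definition open_triangle :: "(real^2) set \<Rightarrow> bool" where
  "open_triangle F \<longleftrightarrow>
     (\<exists>a b c. \<not> collinear {a, b, c} \<and> F = interior (convex hull {a, b, c}))"

definition all_parallel :: "(real^2) set set \<Rightarrow> bool" where
  "all_parallel \<A> \<longleftrightarrow> (\<forall>l\<in>\<A>. \<forall>m\<in>\<A>. affine_parallel l m)"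

definition concurrent :: "(real^2) set set \<Rightarrow> bool" where
  "concurrent \<A> \<longleftrightarrow> (\<exists>p. \<forall>l\<in>\<A>. p \<in> l)"

definition triangular_arrangement :: "(real^2) set set" where
  "triangular_arrangement =
     range (\<lambda>m::int. {p. p $ 1 = of_int m})
     \<union> range (\<lambda>n::int. {p. p $ 2 = of_int n})
     \<union> range (\<lambda>k::int. {p. p $ 1 + p $ 2 = of_int k})"

definition affine_map :: "(real^2 \<Rightarrow> real^2) \<Rightarrow> bool" where
  "affine_map f \<longleftrightarrow> (\<exists>L c. linear L \<and> f = (\<lambda>x. L x + c))"

text \<open>
  The map acts on the family line by line. It need not be required to be invertible: a
  degenerate affine map sends all lines into a single line, so it cannot produce
  the triangular arrangement.
\<close>

definition affinely_triangular :: "(real^2) set set \<Rightarrow> bool" where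
  "affinely_triangular \<A> \<longleftrightarrow>
     (\<exists>f. affine_map f \<and> (\<lambda>l. f ` l) ` \<A> = triangular_arrangement)"

end

theory Submission
  imports Defs
begin

text \<open>
  Fix a line of the arrangement and one of its sides, and send the line to infinity. Lines meeting
  at a vertex of the fixed line become parallel, and each such class has at least two members.
  Where three non-horizontal lines meet, a parallel to the middle one crosses an outer one
  higher up. By local finiteness a highest vertex can be chosen among finitely many lines, and this
  shows that the topmost vertex on any line carries a horizontal line. Back in the plane: if \<open>p\<close> and
  \<open>q\<close> are consecutive vertices on a line, then every line through \<open>p\<close> has a parallel through \<open>q\<close>;
  moreover exactly three lines pass through each vertex. Hence all vertices have the same three
  directions. In coordinates where these are \<open>x\<close>, \<open>y\<close> and \<open>x + y\<close> constant, with a vertex at the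
  origin, the three sets of constants coincide and form a discrete subgroup of the reals.
\<close>

subsection \<open>A half plane with its boundary line at infinity\<close>

text \<open>The obstacle is that the family may be infinite, so an extremal vertex need not exist.
  Local finiteness supplies one only towards the fixed line: height is the reciprocal of the
  coordinate \<open>t\<close> that vanishes on it, so "high" means "near the fixed line", and a line
  has finitely many vertices above any positive height. Slopes \<open>fst n\<close> are positions on
  the fixed line, so lines with slopes in a bounded interval cross a bounded segment of it and are
  finite in number. This is also why topmost vertices matter: if \<open>p\<close> is on the fixed
  line and \<open>q\<close> is the next vertex on another line through \<open>p\<close>, then
  \<open>q\<close> is the topmost vertex of that line, and a horizontal line through
  \<open>q\<close> is a parallel to the fixed line. The number three comes from the parallel
  classes: as soon as the half plane contains a vertex, a third member of a class would produce a
  vertex above the top of the class. So a class has exactly two members, and the fixed line is the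
  third line through the vertex.\<close>

definition xat :: "real \<times> real \<Rightarrow> real \<Rightarrow> real" where
  "xat n y = fst n * y + snd n"

lemma xat_eq_parallel:
  assumes "xat n y = xat m y" "fst n = fst m"
  shows "n = m"
  using assms by (auto simp: xat_def prod_eq_iff)

text \<open>
  An open half plane bounded by a line of the arrangement, after a projective map that sends this
  line to infinity. A pair \<open>(\<alpha>, \<beta>)\<close> in \<open>N\<close> is the line \<open>x = \<alpha> y + \<beta>\<close>, a number \<open>y\<close> in \<open>H\<close> is a horizontal
  line; \<open>1 / t\<close> is the height, so \<open>fin\<close> is local finiteness near infinity. Two lines are parallel
  here iff they meet on the removed line, and \<open>twin\<close> says that no vertex there is ordinary.
\<close>

locale upper_model =
  fixes N :: "(real \<times> real) set" and H :: "real set"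
  assumes fin: "\<And>T R. finite {n \<in> N. \<exists>t. 0 \<le> t \<and> t \<le> T \<and> \<bar>fst n + snd n * t\<bar> \<le> R}"
    and twin: "\<And>n. n \<in> N \<Longrightarrow> \<exists>n'\<in>N. fst n' = fst n \<and> snd n' \<noteq> snd n"
    and cross: "\<And>n m y. \<lbrakk>n \<in> N; m \<in> N; n \<noteq> m; 0 < y; xat n y = xat m y\<rbrakk>
        \<Longrightarrow> y \<in> H \<or> (\<exists>k\<in>N. k \<noteq> n \<and> k \<noteq> m \<and> xat k y = xat n y)"
    and hcross: "\<And>n y. \<lbrakk>n \<in> N; y \<in> H\<rbrakk> \<Longrightarrow> \<exists>k\<in>N. k \<noteq> n \<and> xat k y = xat n y"
    and H_pos: "\<And>y. y \<in> H \<Longrightarrow> 0 < y"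
begin

text \<open>Heights of the vertices on a line. By the axiom \<open>hcross\<close> this includes every height in \<open>H\<close>.\<close>

definition V :: "real \<times> real \<Rightarrow> real set" where
  "V n = {y. 0 < y \<and> (\<exists>k\<in>N. k \<noteq> n \<and> xat k y = xat n y)}"

lemma V_I: "\<lbrakk>k \<in> N; k \<noteq> n; 0 < y; xat k y = xat n y\<rbrakk> \<Longrightarrow> y \<in> V n"
  by (auto simp: V_def)

lemma H_subset_V: "\<lbrakk>n \<in> N; y \<in> H\<rbrakk> \<Longrightarrow> y \<in> V n"
  using hcross[of n y] H_pos[of y] by (simp add: V_def)

lemma finite_fst_between: "finite {n \<in> N. a \<le> fst n \<and> fst n \<le> b}"
proof (rule finite_subset)
  show "finite {n \<in> N. \<exists>t. 0 \<le> t \<and> t \<le> 0 \<and> \<bar>fst n + snd n * t\<bar> \<le> max \<bar>a\<bar> \<bar>b\<bar>}"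
    by (rule fin)
  show "{n \<in> N. a \<le> fst n \<and> fst n \<le> b} \<subseteq> {n \<in> N. \<exists>t. 0 \<le> t \<and> t \<le> 0 \<and> \<bar>fst n + snd n * t\<bar> \<le> max \<bar>a\<bar> \<bar>b\<bar>}"
    by (auto intro!: exI[of _ 0])
qed

text \<open>Heights from \<open>Y\<close> up correspond to parameters \<open>t = 1 / y\<close>
  between 0 and \<open>1 / Y\<close>, where \<open>n\<close> stays in a bounded box. By
  \<open>fin\<close> only finitely many lines meet that box, and each crosses \<open>n\<close> at
  most once.\<close>

lemma finite_V_above:
  assumes "0 < Y"
  shows "finite {y \<in> V n. Y \<le> y}"
proof -
  define K where "K = {k \<in> N. \<exists>t. 0 \<le> t \<and> t \<le> 1 / Y \<and> \<bar>fst k + snd k * t\<bar> \<le> \<bar>fst n\<bar> + \<bar>snd n\<bar> / Y}"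
  have "{y \<in> V n. Y \<le> y} \<subseteq> (\<lambda>k. (snd n - snd k) / (fst k - fst n)) ` K"
  proof
    fix y assume "y \<in> {y \<in> V n. Y \<le> y}"
    then obtain k where k: "0 < y" "Y \<le> y" "k \<in> N" "k \<noteq> n" "xat k y = xat n y"
      by (auto simp: V_def)
    have ne: "fst k \<noteq> fst n"
      using k xat_eq_parallel by metis
    have y: "y = (snd n - snd k) / (fst k - fst n)"
      using k(5) ne by (simp add: xat_def field_simps)
    have le: "1 / y \<le> 1 / Y"
      using k assms by (simp add: frac_le)
    have "fst k + snd k * (1 / y) = fst n + snd n * (1 / y)"
      using k(1,5) by (simp add: xat_def field_simps)
    also have "\<bar>\<dots>\<bar> \<le> \<bar>fst n\<bar> + \<bar>snd n\<bar> * (1 / y)"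
      using k(1) abs_triangle_ineq[of "fst n" "snd n * (1 / y)"] by (simp add: abs_mult)
    also have "\<dots> \<le> \<bar>fst n\<bar> + \<bar>snd n\<bar> * (1 / Y)"
      using le by (intro add_left_mono mult_left_mono) auto
    finally have "k \<in> K"
      using k(1,3) le unfolding K_def by (auto intro!: exI[of _ "1 / y"])
    then show "y \<in> (\<lambda>k. (snd n - snd k) / (fst k - fst n)) ` K"
      using y by blast
  qed
  moreover have "finite K"
    unfolding K_def by (rule fin)
  ultimately show ?thesis
    using finite_subset by blast
qed

text \<open>Only heights from \<open>y0\<close> up compete, and there are finitely many of them on
  each line, although \<open>V m\<close> itself may be infinite.\<close>

lemma highest_vertex:
  assumes "finite M" "m0 \<in> M" "y0 \<in> V m0"
  obtains m y where "m \<in> M" "y \<in> V m" "\<And>m' y'. \<lbrakk>m' \<in> M; y' \<in> V m'\<rbrakk> \<Longrightarrow> y' \<le> y"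
proof -
  define S where "S = (\<Union>m\<in>M. {y \<in> V m. y0 \<le> y})"
  have "0 < y0"
    using assms(3) by (simp add: V_def)
  then have fS: "finite S"
    unfolding S_def using assms(1) finite_V_above by blast
  have y0: "y0 \<in> S"
    using assms by (auto simp: S_def)
  have "Max S \<in> S"
    using fS y0 Max_in by blast
  then obtain m where m: "m \<in> M" "Max S \<in> V m"
    by (auto simp: S_def)
  have "y' \<le> Max S" if "m' \<in> M" "y' \<in> V m'" for m' y'
  proof (cases "y0 \<le> y'")
    case True
    then have "y' \<in> S" using that by (auto simp: S_def)
    then show ?thesis using fS by simp
  next
    case False
    then show ?thesis using Max_ge[OF fS y0] by linarith
  qed
  then show ?thesis using that m by blast
qed

text \<open>\<open>fst\<close> is the slope measured as \<open>x\<close> per unit of height: a line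
  on the right that moves right more slowly is overtaken higher up.\<close>

lemma cross_above:
  assumes "n \<in> N" "m \<in> N" "0 < y" "fst n < fst m" "xat m y < xat n y"
  shows "\<exists>y'>y. y' \<in> V n \<and> y' \<in> V m"
proof -
  define z where "z = (snd n - snd m) / (fst m - fst n)"
  have "y < z"
    using assms(4,5) by (simp add: z_def xat_def field_simps)
  moreover have "xat m z = xat n z"
    using assms(4) by (simp add: z_def xat_def divide_simps) (simp add: algebra_simps)
  moreover have "n \<noteq> m" using assms(4) by auto
  ultimately show ?thesis
    using assms V_I[of m n z] V_I[of n m z] by auto
qed

text \<open>The twin of the middle line cannot avoid both outer lines above the meeting point.\<close>

lemma three_meeting:
  assumes "n \<in> N" "m \<in> N" "k \<in> N" "0 < y" "fst n < fst m" "fst m < fst k"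
    and "xat n y = xat m y" "xat k y = xat m y"
  shows "\<exists>y'>y. y' \<in> V n \<or> y' \<in> V k"
proof -
  obtain m' where m': "m' \<in> N" "fst m' = fst m" "snd m' \<noteq> snd m"
    using twin assms(2) by blast
  show ?thesis
  proof (cases "snd m < snd m'")
    case True
    then have "xat k y < xat m' y"
      using assms(8) m'(2) by (simp add: xat_def)
    then show ?thesis
      using cross_above[of m' k y] assms m' by auto
  next
    case False
    then have "xat m' y < xat n y"
      using assms(7) m'(2,3) by (simp add: xat_def)
    then show ?thesis
      using cross_above[of n m' y] assms m' by auto
  qed
qed

text \<open>
  Let \<open>u\<close> be the leftmost line through the top vertex of \<open>a\<close>. Among \<open>u\<close> and the lines with direction
  strictly between those of \<open>u\<close> and \<open>a\<close>, take a highest vertex: it lies in the wedge spanned by \<open>u\<close>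
  and \<open>a\<close>, so every line through it belongs to the same family, and three such lines produce a
  higher vertex.
\<close>

lemma no_left_top:
  assumes a: "a \<in> N" and y: "y \<in> V a" and top: "\<And>y'. y' \<in> V a \<Longrightarrow> y' \<le> y" and nH: "y \<notin> H"
    and leftmost: "\<And>n. \<lbrakk>n \<in> N; fst n = fst a\<rbrakk> \<Longrightarrow> snd a \<le> snd n"
    and left: "\<And>n. \<lbrakk>n \<in> N; n \<noteq> a; xat n y = xat a y\<rbrakk> \<Longrightarrow> fst n < fst a"
  shows False
proof -
  define W where "W = {n \<in> N. n \<noteq> a \<and> xat n y = xat a y}"
  have y0: "0 < y" using y by (simp add: V_def)
  have Wfst: "fst n \<noteq> fst m" if "n \<in> W" "m \<in> W" "n \<noteq> m" for n m
    using that xat_eq_parallel[of n y m] by (auto simp: W_def)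
  have finW: "finite W"
  proof (rule finite_subset)
    let ?S = "{n \<in> N. \<exists>t. 0 \<le> t \<and> t \<le> 1 / y \<and> \<bar>fst n + snd n * t\<bar> \<le> \<bar>fst a + snd a * (1 / y)\<bar>}"
    show "finite ?S" by (rule fin)
    show "W \<subseteq> ?S"
    proof
      fix n assume n: "n \<in> W"
      then have "fst n + snd n * (1 / y) = fst a + snd a * (1 / y)"
        using y0 by (simp add: W_def xat_def field_simps)
      then show "n \<in> ?S"
        using n y0 by (auto simp: W_def intro!: exI[of _ "1 / y"])
    qed
  qed
  obtain k1 where k1: "k1 \<in> W"
    using y by (auto simp: V_def W_def)
  \<comment> \<open>Without a horizontal line at \<open>y\<close> there are at least two lines
    through the vertex besides \<open>a\<close>, so one has its slope strictly between those of the
    extreme line \<open>u\<close> and \<open>a\<close>.\<close>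
  obtain k2 where k2: "k2 \<in> W" "k2 \<noteq> k1"
    using cross[of a k1 y] nH a k1 y0 by (auto simp: W_def)
  obtain u where u: "u \<in> W" "\<And>n. n \<in> W \<Longrightarrow> fst u \<le> fst n"
    using finW k1 ex_min_if_finite[of "fst ` W"] by (metis (no_types, lifting) empty_iff finite_imageI imageE image_eqI not_le)
  obtain u2 where u2: "u2 \<in> W" "fst u < fst u2"
    using k1 k2 u Wfst by (metis order_le_less)
  have uN: "u \<in> N" "fst u < fst a" "xat u y = xat a y" "u \<noteq> a"
    using u left by (auto simp: W_def)
  have u2N: "u2 \<in> N" "fst u2 < fst a" "xat u2 y = xat a y" "u2 \<noteq> a"
    using u2 left by (auto simp: W_def)
  define M where "M = {n \<in> N. fst u < fst n \<and> fst n < fst a} \<union> {u}"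
  have MN: "M \<subseteq> N" using uN by (auto simp: M_def)
  have "finite {n \<in> N. fst u < fst n \<and> fst n < fst a}"
    by (rule finite_subset[OF _ finite_fst_between[of "fst u" "fst a"]]) auto
  then have finM: "finite M"
    by (simp add: M_def)
  have uM: "u \<in> M" by (simp add: M_def)
  have yu: "y \<in> V u"
    using V_I[of a u y] a uN y0 by auto
  obtain m z where m: "m \<in> M" "z \<in> V m" and high: "\<And>m' y'. \<lbrakk>m' \<in> M; y' \<in> V m'\<rbrakk> \<Longrightarrow> y' \<le> z"
    using highest_vertex[OF finM uM yu] by blast
  have yz: "y \<le> z" using high uM yu by blast
  have z0: "0 < z" using y0 yz by linarith
  have mN: "m \<in> N" "fst u \<le> fst m" "fst m < fst a"
    using m MN uN by (auto simp: M_def)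
  \<comment> \<open>Right of \<open>a\<close> and with a smaller slope, \<open>m\<close> would cross
    \<open>a\<close> above \<open>z\<close>, against the choice of \<open>z\<close>. The bound
    \<open>um\<close> is the same argument with \<open>u\<close>.\<close>
  have ma: "xat m z \<le> xat a z"
    using cross_above[OF mN(1) a z0 mN(3)] high[OF m(1)] by force
  have um: "xat u z \<le> xat m z"
  proof (cases "m = u")
    case False
    then have "fst u < fst m" using m(1) by (auto simp: M_def)
    then show ?thesis
      using cross_above[OF uN(1) mN(1) z0] high[OF m(1)] by force
  qed simp
  show False
  proof (cases "z = y")
    case True
    \<comment> \<open>Here the highest vertex is the starting one: the higher vertex contradicts
      \<open>high\<close> if it is on \<open>u\<close> and \<open>top\<close> if it is on
      \<open>a\<close>.\<close>
    have "\<exists>y'>y. y' \<in> V u \<or> y' \<in> V a"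
      by (rule three_meeting[OF uN(1) u2N(1) a y0 u2(2) u2N(2)]) (simp_all add: uN u2N)
    then obtain y' where "y < y'" "y' \<in> V u \<or> y' \<in> V a" by blast
    then show False
      using high[OF uM, of y'] top[of y'] True by fastforce
  next
    case False
    then have yz: "y < z" using yz by simp
    have aV: "z' \<notin> V a" if "y < z'" for z'
      using top that by force
    have zH: "z \<notin> H"
      using H_subset_V[OF a] aV yz by blast
    \<comment> \<open>The slope cannot reach that of \<open>a\<close>: a parallel would lie to the
      left of the leftmost line \<open>a\<close>, and a larger slope would lead to a crossing with
      \<open>a\<close> above \<open>z\<close>.\<close>
    have inM: "n \<in> M" if n: "n \<in> N" "xat n z = xat m z" for n
    proof -
      have na: "n \<noteq> a"
      proof
        assume "n = a"
        then have "z \<in> V a"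
          using V_I[OF mN(1) _ z0, of a] mN(3) n(2) by auto
        then show False using aV[OF yz] by blast
      qed
      have "xat n z \<noteq> xat a z"
        using V_I[OF n(1) na z0] aV[OF yz] by blast
      then have lt: "xat n z < xat a z"
        using n(2) ma by simp
      have "fst n \<noteq> fst a"
        using leftmost[OF n(1)] lt by (auto simp: xat_def)
      moreover have "\<not> fst a < fst n"
      proof
        assume "fst a < fst n"
        from cross_above[OF a n(1) z0 this lt] obtain z' where "z < z'" "z' \<in> V a"
          by blast
        then show False
          using aV[of z'] yz by simp
      qed
      ultimately have 1: "fst n < fst a" by linarith
      \<comment> \<open>Otherwise \<open>n\<close>, followed down from \<open>z\<close> to
        \<open>y\<close>, arrives at the meeting point of \<open>u\<close> and \<open>a\<close> or
        right of it. The first contradicts that \<open>u\<close> is extreme in \<open>W\<close>; in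
        the second case \<open>n\<close> crosses \<open>a\<close> above \<open>y\<close>.\<close>
      have "fst u < fst n \<or> n = u"
      proof (rule ccontr)
        assume "\<not> ?thesis"
        then have nu: "fst n \<le> fst u" "n \<noteq> u" by auto
        have "fst n * (z - y) \<le> fst u * (z - y)"
          using nu yz by (intro mult_right_mono) auto
        then have ge: "xat a y \<le> xat n y"
          using um n(2) uN(3) by (simp add: xat_def algebra_simps)
        show False
        proof (cases "xat n y = xat a y")
          case True
          then have "n \<in> W" using n na by (simp add: W_def)
          then show False
            using u(2)[of n] nu Wfst[OF _ u(1), of n] by simp
        next
          case False
          then have "xat a y < xat n y" using ge by simp
          from cross_above[OF n(1) a y0 1 this] obtain y' where "y < y'" "y' \<in> V a"
            by blast
          then show False using top[of y'] by simp
        qed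
      qed
      then show ?thesis using 1 n by (auto simp: M_def)
    qed
    obtain k where k: "k \<in> N" "k \<noteq> m" "xat k z = xat m z"
      using m(2) by (auto simp: V_def)
    obtain j where j: "j \<in> N" "j \<noteq> m" "j \<noteq> k" "xat j z = xat m z"
      using cross[OF mN(1) k(1) _ z0] k zH by metis
    have d: "fst k \<noteq> fst m" "fst j \<noteq> fst m" "fst j \<noteq> fst k"
      using xat_eq_parallel k j by metis+
    \<comment> \<open>Three lines with distinct slopes at the highest vertex: the outer two are in
      \<open>M\<close>, so the vertex from \<open>three_meeting\<close> contradicts
      \<open>high\<close>.\<close>
    have three: False if "p1 \<in> N" "p2 \<in> N" "p3 \<in> N" "fst p1 < fst p2" "fst p2 < fst p3"
      "xat p1 z = xat m z" "xat p2 z = xat m z" "xat p3 z = xat m z" for p1 p2 p3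
    proof -
      have "\<exists>y'>z. y' \<in> V p1 \<or> y' \<in> V p3"
        by (rule three_meeting[OF that(1-3) z0 that(4,5)]) (simp_all add: that)
      then obtain y' where "z < y'" "y' \<in> V p1 \<or> y' \<in> V p3" by blast
      then show False
        using high[OF inM[OF that(1,6)], of y'] high[OF inM[OF that(3,8)], of y'] by fastforce
    qed
    consider "fst k < fst m" "fst m < fst j" | "fst j < fst m" "fst m < fst k"
      | "fst k < fst j" "fst j < fst m" | "fst m < fst j" "fst j < fst k"
      | "fst m < fst k" "fst k < fst j" | "fst j < fst k" "fst k < fst m"
      using d by linarith
    then show False
      using three[OF k(1) mN(1) j(1)] three[OF j(1) mN(1) k(1)] three[OF k(1) j(1) mN(1)]
        three[OF mN(1) j(1) k(1)] three[OF mN(1) k(1) j(1)] three[OF j(1) k(1) mN(1)] k j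
      by cases simp_all
  qed
qed

end

text \<open>The mirror image keeps all heights and exchanges left and right, so
  \<open>no_left_top\<close> also yields its symmetric counterpart.\<close>

lemma upper_model_reflect:
  assumes "upper_model N H"
  shows "upper_model (uminus ` N) H"
proof -
  interpret upper_model N H by fact
  have x: "xat (- n) y = - xat n y" for n y
    by (simp add: xat_def)
  have x': "xat (- n) y = xat (- m) y \<longleftrightarrow> xat n y = xat m y" for n m y
    by (simp add: x)
  show ?thesis
  proof
    fix T R
    have "{n \<in> uminus ` N. \<exists>t. 0 \<le> t \<and> t \<le> T \<and> \<bar>fst n + snd n * t\<bar> \<le> R}
        \<subseteq> uminus ` {n \<in> N. \<exists>t. 0 \<le> t \<and> t \<le> T \<and> \<bar>fst n + snd n * t\<bar> \<le> R}"
    proof clarsimp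
      fix a b t assume "(a, b) \<in> N" "0 \<le> t" "t \<le> T" "\<bar>- a - b * t\<bar> \<le> R"
      moreover from this have "\<bar>a + b * t\<bar> \<le> R" by linarith
      ultimately show "(- a, - b) \<in> uminus ` {n \<in> N. \<exists>t\<ge>0. t \<le> T \<and> \<bar>fst n + snd n * t\<bar> \<le> R}"
        by (auto intro!: image_eqI[of _ _ "(a, b)"])
    qed
    then show "finite {n \<in> uminus ` N. \<exists>t. 0 \<le> t \<and> t \<le> T \<and> \<bar>fst n + snd n * t\<bar> \<le> R}"
      using fin finite_surj by blast
  next
    fix n assume "n \<in> uminus ` N"
    then show "\<exists>n'\<in>uminus ` N. fst n' = fst n \<and> snd n' \<noteq> snd n"
      using twin by fastforce
  next
    fix n m y assume nm: "n \<in> uminus ` N" "m \<in> uminus ` N" "n \<noteq> m" "0 < (y::real)" "xat n y = xat m y"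
    then obtain n' m' where "n' \<in> N" "m' \<in> N" "n = - n'" "m = - m'"
      by blast
    then show "y \<in> H \<or> (\<exists>k\<in>uminus ` N. k \<noteq> n \<and> k \<noteq> m \<and> xat k y = xat n y)"
      using nm cross[of n' m' y] x' by (metis image_eqI minus_equation_iff)
  next
    fix n y assume "n \<in> uminus ` N" "y \<in> H"
    then obtain n' where "n' \<in> N" "n = - n'" by blast
    then show "\<exists>k\<in>uminus ` N. k \<noteq> n \<and> xat k y = xat n y"
      using hcross[of n' y] \<open>y \<in> H\<close> x' by (metis image_eqI minus_equation_iff)
  next
    fix y assume "y \<in> H" then show "0 < y" by (rule H_pos)
  qed
qed

context upper_model
begin

lemma no_right_top:
  assumes a: "a \<in> N" and y: "y \<in> V a" and top: "\<And>y'. y' \<in> V a \<Longrightarrow> y' \<le> y" and nH: "y \<notin> H"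
    and rightmost: "\<And>n. \<lbrakk>n \<in> N; fst n = fst a\<rbrakk> \<Longrightarrow> snd n \<le> snd a"
    and right: "\<And>n. \<lbrakk>n \<in> N; n \<noteq> a; xat n y = xat a y\<rbrakk> \<Longrightarrow> fst a < fst n"
  shows False
proof -
  interpret R: upper_model "uminus ` N" H
    by (rule upper_model_reflect) (rule upper_model_axioms)
  have x: "xat (- n) y = - xat n y" for n y
    by (simp add: xat_def)
  have V: "R.V (- n) = V n" for n
    by (auto simp: R.V_def V_def x)
  show False
  proof (rule R.no_left_top[of "- a" y])
    fix n assume "n \<in> uminus ` N" "fst n = fst (- a)"
    then show "snd (- a) \<le> snd n" using rightmost by auto
  next
    fix n assume n: "n \<in> uminus ` N" "n \<noteq> - a" "xat n y = xat (- a) y"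
    then obtain n' where "n' \<in> N" "n = - n'" by blast
    then show "fst n < fst (- a)" using n right[of n'] by (auto simp: x)
  qed (use assms V in auto)
qed

text \<open>Take the highest vertex of the whole class, on \<open>m\<close>, and suppose it has no
  horizontal line. If \<open>m\<close> has a twin on its right, every other line through the vertex
  has smaller slope, since otherwise it would cross the twin higher up. Then \<open>m\<close> has no
  parallel on its left for the same reason, and \<open>no_left_top\<close> applies. A twin on the
  left is the mirror case.\<close>

lemma class_top:
  assumes "n \<in> N" "V n \<noteq> {}"
  obtains y where "y \<in> H" "\<And>k y'. \<lbrakk>k \<in> N; fst k = fst n; y' \<in> V k\<rbrakk> \<Longrightarrow> y' \<le> y"
proof -
  define C where "C = {k \<in> N. fst k = fst n}"
  have "finite C"
    by (rule finite_subset[OF _ finite_fst_between[of "fst n" "fst n"]]) (auto simp: C_def)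
  moreover have "n \<in> C" using assms by (simp add: C_def)
  moreover obtain y0 where "y0 \<in> V n" using assms by blast
  ultimately obtain m y where m: "m \<in> C" "y \<in> V m"
    and high: "\<And>m' y'. \<lbrakk>m' \<in> C; y' \<in> V m'\<rbrakk> \<Longrightarrow> y' \<le> y"
    using highest_vertex by metis
  have y0: "0 < y" using m by (simp add: V_def)
  have mN: "m \<in> N" "fst m = fst n" using m by (auto simp: C_def)
  have "y \<in> H"
  proof (rule ccontr)
    assume nH: "y \<notin> H"
    obtain k where k: "k \<in> N" "k \<noteq> m" "xat k y = xat m y"
      using m(2) by (auto simp: V_def)
    have ne: "fst j \<noteq> fst m" if "j \<noteq> m" "xat j y = xat m y" for j
      using that xat_eq_parallel by blast
    obtain m' where m': "m' \<in> N" "fst m' = fst m" "snd m' \<noteq> snd m"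
      using twin mN by blast
    have right: "\<not> fst m < fst j" if "j \<in> N" "xat j y = xat m y" "c \<in> N" "fst c = fst m" "snd m < snd c" for j c
    proof
      assume "fst m < fst j"
      moreover have "xat j y < xat c y" using that by (simp add: xat_def)
      ultimately have "\<exists>y'>y. y' \<in> V c \<and> y' \<in> V j"
        using cross_above[of c j y] that y0 by simp
      then show False using high[of c] that mN by (force simp: C_def)
    qed
    have left: "\<not> fst j < fst m" if "j \<in> N" "xat j y = xat m y" "c \<in> N" "fst c = fst m" "snd c < snd m" for j c
    proof
      assume "fst j < fst m"
      moreover have "xat c y < xat j y" using that by (simp add: xat_def)
      ultimately have "\<exists>y'>y. y' \<in> V j \<and> y' \<in> V c"
        using cross_above[of j c y] that y0 by simp
      then show False using high[of c] that mN by (force simp: C_def)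
    qed
    show False
    proof (cases "snd m < snd m'")
      case True
      have lt: "fst j < fst m" if "j \<in> N" "j \<noteq> m" "xat j y = xat m y" for j
        using right[OF that(1,3) m'(1,2) True] ne[OF that(2,3)] by linarith
      show False
      proof (rule no_left_top[OF mN(1) m(2) high[OF m(1)] nH _ lt])
        fix c assume "c \<in> N" "fst c = fst m"
        then show "snd m \<le> snd c"
          using left[OF k(1,3), of c] lt[OF k] by force
      qed
    next
      case False
      then have less: "snd m' < snd m" using m'(3) by simp
      have gt: "fst m < fst j" if "j \<in> N" "j \<noteq> m" "xat j y = xat m y" for j
        using left[OF that(1,3) m'(1,2) less] ne[OF that(2,3)] by linarith
      show False
      proof (rule no_right_top[OF mN(1) m(2) high[OF m(1)] nH _ gt])
        fix c assume "c \<in> N" "fst c = fst m"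
        then show "snd c \<le> snd m"
          using right[OF k(1,3), of c] gt[OF k] by force
      qed
    qed
  qed
  then show ?thesis
    using that high by (auto simp: C_def)
qed

text \<open>The top height of the class carries a horizontal line, which by \<open>hcross\<close>
  makes a vertex on every member; hence all members have the same top.\<close>

lemma top_horizontal:
  assumes "n \<in> N" "y \<in> V n" "\<And>y'. y' \<in> V n \<Longrightarrow> y' \<le> y"
  shows "y \<in> H"
proof -
  obtain z where z: "z \<in> H" "\<And>k y'. \<lbrakk>k \<in> N; fst k = fst n; y' \<in> V k\<rbrakk> \<Longrightarrow> y' \<le> z"
    using class_top[of n] assms by blast
  have "z = y"
    using z(2)[OF assms(1) refl assms(2)] assms(3)[OF H_subset_V[OF assms(1) z(1)]] by simp
  then show ?thesis using z(1) by simp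
qed

lemma parallel_at_most_two:
  assumes "m \<in> N" "V m \<noteq> {}" and c: "c1 \<in> N" "c2 \<in> N" "c3 \<in> N" "fst c1 = fst c2" "fst c3 = fst c2"
  shows "\<not> (snd c1 < snd c2 \<and> snd c2 < snd c3)"
proof
  assume lt: "snd c1 < snd c2 \<and> snd c2 < snd c3"
  \<comment> \<open>One vertex anywhere makes \<open>H\<close> nonempty, and a horizontal line gives
    every line of \<open>N\<close> a vertex; so the class of \<open>c2\<close> has a top
    height.\<close>
  obtain z where "z \<in> H" using class_top assms by metis
  then have "V c2 \<noteq> {}" using H_subset_V c by blast
  then obtain y where y: "y \<in> H" "\<And>k y'. \<lbrakk>k \<in> N; fst k = fst c2; y' \<in> V k\<rbrakk> \<Longrightarrow> y' \<le> y"
    using class_top[of c2] c by blast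
  obtain k where k: "k \<in> N" "k \<noteq> c2" "xat k y = xat c2 y"
    using hcross[OF c(2) y(1)] by blast
  have y0: "0 < y" using y H_pos by blast
  have "fst k \<noteq> fst c2" using k xat_eq_parallel by blast
  then consider "fst k < fst c2" | "fst c2 < fst k" by linarith
  then show False
  proof cases
    case 1
    have "xat c1 y < xat k y" using k lt c by (simp add: xat_def)
    then show False
      using cross_above[OF k(1) c(1) y0] 1 c y(2)[OF c(1,4)] by force
  next
    case 2
    have "xat k y < xat c3 y" using k lt c by (simp add: xat_def)
    then show False
      using cross_above[OF c(3) k(1) y0] 2 c y(2)[OF c(3,5)] by force
  qed
qed

end

subsection \<open>Lines in affine coordinates\<close>

lemma is_line_affine_hull:
  assumes "is_line m" "p \<in> m" "q \<in> m" "p \<noteq> q"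
  shows "m = affine hull {p, q}"
proof -
  have "affine hull {p, q} \<subseteq> m"
    using assms by (simp add: is_line_def hull_minimal)
  moreover have "aff_dim (affine hull {p, q}) = aff_dim m"
    using assms by (simp add: is_line_def aff_dim_2)
  ultimately show ?thesis
    using affine_dim_equal[of "affine hull {p, q}" m] assms(1)
    by (simp add: is_line_def)
qed

lemma is_line_eqI:
  assumes "is_line l" "is_line m" "p \<in> l" "p \<in> m" "q \<in> l" "q \<in> m" "p \<noteq> q"
  shows "l = m"
  using assms is_line_affine_hull by metis

lemma is_line_param:
  assumes "is_line m" "p \<in> m"
  obtains u where "u \<noteq> 0" "m = range (\<lambda>r. p + r *\<^sub>R u)"
proof -
  have "m \<noteq> {p}"
    using assms by (auto simp: is_line_def)
  then obtain q where q: "q \<in> m" "q \<noteq> p" using assms by blast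
  then have "m = range (\<lambda>r. p + r *\<^sub>R (q - p))"
    using is_line_affine_hull[OF assms q(1)] affine_hull_2_alt[of p q] by metis
  then show ?thesis using that[of "q - p"] q by simp
qed

lemma is_line_nonempty: "is_line m \<Longrightarrow> m \<noteq> {}"
  by (auto simp: is_line_def)

lemma affine_parallel_meet_eq:
  assumes "is_line l" "affine_parallel l m" "p \<in> l" "p \<in> m"
  shows "l = m"
proof -
  obtain u where u: "l = range (\<lambda>r. p + r *\<^sub>R u)"
    using is_line_param assms by metis
  obtain a where a: "m = (+) a ` l"
    using assms(2) by (auto simp: affine_parallel_def)
  then obtain r0 where r0: "p = a + (p + r0 *\<^sub>R u)"
    using assms(4) u by auto
  then have "a = - r0 *\<^sub>R u"
    by (simp add: algebra_simps eq_neg_iff_add_eq_0)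
  then have m: "m = range (\<lambda>r. p + (r - r0) *\<^sub>R u)"
    by (simp add: a u image_image algebra_simps)
  show ?thesis
  proof
    show "l \<subseteq> m"
    proof
      fix x assume "x \<in> l"
      then obtain r where "x = p + r *\<^sub>R u" using u by auto
      then have "x = p + ((r + r0) - r0) *\<^sub>R u" by simp
      then show "x \<in> m" unfolding m by blast
    qed
    show "m \<subseteq> l" by (auto simp: m u)
  qed
qed

locale frame =
  fixes orig v w :: "real^2"
  assumes det: "v $ 1 * w $ 2 - v $ 2 * w $ 1 \<noteq> 0"
begin

definition pt :: "real \<Rightarrow> real \<Rightarrow> real^2" where
  "pt s t = orig + s *\<^sub>R v + t *\<^sub>R w"

definition Hz :: "real \<Rightarrow> (real^2) set" where
  "Hz t = range (\<lambda>s. pt s t)"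

text \<open>Writing \<open>s\<close> as a function of \<open>t\<close> makes the parallels
  \<open>Hz t\<close> of the base the only exceptional lines.\<close>

definition Ln :: "real \<Rightarrow> real \<Rightarrow> (real^2) set" where
  "Ln \<alpha> \<beta> = range (\<lambda>t. pt (\<alpha> + \<beta> * t) t)"

text \<open>Cramer's rule for \<open>p - orig\<close> in the basis \<open>v\<close>,
  \<open>w\<close>; likewise \<open>crd2\<close>.\<close>

definition crd1 :: "real^2 \<Rightarrow> real" where
  "crd1 p = ((p - orig) $ 1 * w $ 2 - (p - orig) $ 2 * w $ 1) / (v $ 1 * w $ 2 - v $ 2 * w $ 1)"

definition crd2 :: "real^2 \<Rightarrow> real" where
  "crd2 p = (v $ 1 * (p - orig) $ 2 - v $ 2 * (p - orig) $ 1) / (v $ 1 * w $ 2 - v $ 2 * w $ 1)"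

lemma crd_pt [simp]: "crd1 (pt s t) = s" "crd2 (pt s t) = t"
  using det by (simp_all add: crd1_def crd2_def pt_def field_simps)

lemma pt_crd [simp]: "pt (crd1 p) (crd2 p) = p"
proof -
  define d where "d = v $ 1 * w $ 2 - v $ 2 * w $ 1"
  have "d \<noteq> 0" using det d_def by simp
  then show ?thesis
    unfolding pt_def crd1_def crd2_def d_def[symmetric]
    by (simp add: vec_eq_iff forall_2 divide_simps) (simp add: d_def algebra_simps)
qed

lemma pt_eq_iff [simp]: "pt s t = pt s' t' \<longleftrightarrow> s = s' \<and> t = t'"
  by (metis crd_pt)

lemma pt_in_Hz [simp]: "pt s t \<in> Hz t' \<longleftrightarrow> t = t'"
  by (auto simp: Hz_def)

lemma pt_in_Ln [simp]: "pt s t \<in> Ln \<alpha> \<beta> \<longleftrightarrow> s = \<alpha> + \<beta> * t"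
  by (auto simp: Ln_def)

lemma pt_0_0: "pt 0 0 = orig" and pt_0_1: "pt 0 1 = orig + w"
  by (simp_all add: pt_def)

lemma orig_in [simp]: "orig \<in> Hz t \<longleftrightarrow> t = 0" "orig \<in> Ln \<alpha> \<beta> \<longleftrightarrow> \<alpha> = 0"
  using pt_in_Hz[of 0 0 t] pt_in_Ln[of 0 0 \<alpha> \<beta>] unfolding pt_0_0 by auto

lemma orig_plus_in [simp]: "orig + w \<in> Hz t \<longleftrightarrow> t = 1" "orig + w \<in> Ln \<alpha> \<beta> \<longleftrightarrow> \<alpha> + \<beta> = 0"
  using pt_in_Hz[of 0 1 t] pt_in_Ln[of 0 1 \<alpha> \<beta>] unfolding pt_0_1 by auto

lemma Hz_eq_iff [simp]: "Hz t = Hz t' \<longleftrightarrow> t = t'"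
  by (metis pt_in_Hz)

lemma Ln_eq_iff [simp]: "Ln \<alpha> \<beta> = Ln \<alpha>' \<beta>' \<longleftrightarrow> \<alpha> = \<alpha>' \<and> \<beta> = \<beta>'"
proof
  assume eq: "Ln \<alpha> \<beta> = Ln \<alpha>' \<beta>'"
  have "pt \<alpha> 0 \<in> Ln \<alpha>' \<beta>'" "pt (\<alpha> + \<beta>) 1 \<in> Ln \<alpha>' \<beta>'"
    unfolding eq[symmetric] by simp_all
  then show "\<alpha> = \<alpha>' \<and> \<beta> = \<beta>'" by simp
qed simp

lemma Hz_neq_Ln [simp]: "Hz t \<noteq> Ln \<alpha> \<beta>" "Ln \<alpha> \<beta> \<noteq> Hz t"
proof -
  have "pt (\<alpha> + \<beta> * t + 1) t \<in> Hz t" "pt (\<alpha> + \<beta> * t + 1) t \<notin> Ln \<alpha> \<beta>"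
    by simp_all
  then show "Hz t \<noteq> Ln \<alpha> \<beta>" "Ln \<alpha> \<beta> \<noteq> Hz t" by blast+
qed

lemma line_cases [consumes 1, case_names Hz Ln]:
  assumes "is_line m"
  obtains (Hz) t where "m = Hz t" | (Ln) \<alpha> \<beta> where "m = Ln \<alpha> \<beta>"
proof -
  obtain p where p: "p \<in> m" using is_line_nonempty assms by blast
  obtain u where u: "u \<noteq> 0" "m = range (\<lambda>r. p + r *\<^sub>R u)"
    using is_line_param assms p by metis
  define s0 t0 a b where "s0 = crd1 p" "t0 = crd2 p" "a = crd1 (orig + u)" "b = crd2 (orig + u)"
  note defs = this
  have "orig + u = pt a b" by (simp add: defs)
  then have u': "u = a *\<^sub>R v + b *\<^sub>R w" by (simp add: pt_def)
  have "p = pt s0 t0" by (simp add: defs)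
  then have m: "m = range (\<lambda>r. pt (s0 + r * a) (t0 + r * b))"
    unfolding u(2) u' by (simp add: pt_def algebra_simps)
  show ?thesis
  proof (cases "b = 0")
    case True
    then have a: "a \<noteq> 0" using u u' by auto
    have "m = Hz t0"
    proof
      show "Hz t0 \<subseteq> m"
      proof
        fix x assume "x \<in> Hz t0"
        then obtain s where "x = pt s t0" by (auto simp: Hz_def)
        then have "x = pt (s0 + ((s - s0) / a) * a) (t0 + ((s - s0) / a) * b)"
          using True a by simp
        then show "x \<in> m" unfolding m by blast
      qed
    qed (auto simp: m True)
    then show ?thesis by (rule Hz)
  next
    case False
    have "m = Ln (s0 - a / b * t0) (a / b)"
    proof
      show "Ln (s0 - a / b * t0) (a / b) \<subseteq> m"
      proof
        fix x assume "x \<in> Ln (s0 - a / b * t0) (a / b)"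
        then obtain t where "x = pt (s0 - a / b * t0 + a / b * t) t" by (auto simp: Ln_def)
        then have "x = pt (s0 + ((t - t0) / b) * a) (t0 + ((t - t0) / b) * b)"
          using False by (simp add: field_simps)
        then show "x \<in> m" unfolding m by blast
      qed
    qed (use False in \<open>auto simp: m field_simps\<close>)
    then show ?thesis by (rule Ln)
  qed
qed

lemma parallel_Hz: "affine_parallel (Hz t) (Hz t')"
  unfolding affine_parallel_def
proof
  show "Hz t' = (+) ((t' - t) *\<^sub>R w) ` Hz t"
    by (simp add: Hz_def image_image pt_def algebra_simps)
qed

lemma parallel_Hz_iff:
  assumes "is_line m"
  shows "affine_parallel (Hz t) m \<longleftrightarrow> (\<exists>t'. m = Hz t')"
proof
  assume par: "affine_parallel (Hz t) m"
  show "\<exists>t'. m = Hz t'"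
  using assms
  proof (cases rule: line_cases)
    case (Ln \<alpha> \<beta>)
    have "m = Hz t"
      by (rule affine_parallel_meet_eq[OF assms, of _ "pt (\<alpha> + \<beta> * t) t"])
        (use affine_parallel_commute[OF par] Ln in auto)
    then show ?thesis by blast
  qed blast
qed (auto simp: parallel_Hz)

lemma parallel_Ln: "affine_parallel (Ln \<alpha> \<beta>) (Ln \<alpha>' \<beta>)"
  unfolding affine_parallel_def
proof
  show "Ln \<alpha>' \<beta> = (+) ((\<alpha>' - \<alpha>) *\<^sub>R v) ` Ln \<alpha> \<beta>"
    by (simp add: Ln_def image_image pt_def algebra_simps)
qed

lemma parallel_Ln_iff:
  assumes "is_line m"
  shows "affine_parallel (Ln \<alpha> \<beta>) m \<longleftrightarrow> (\<exists>\<alpha>'. m = Ln \<alpha>' \<beta>)"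
proof
  assume par: "affine_parallel (Ln \<alpha> \<beta>) m"
  then have par': "affine_parallel m (Ln \<alpha> \<beta>)"
    using affine_parallel_commute by blast
  show "\<exists>\<alpha>'. m = Ln \<alpha>' \<beta>"
  using assms
  proof (cases rule: line_cases)
    case (Hz t)
    have "m = Ln \<alpha> \<beta>"
      by (rule affine_parallel_meet_eq[OF assms par', of "pt (\<alpha> + \<beta> * t) t"])
        (use Hz in auto)
    then show ?thesis by blast
  next
    case (Ln \<alpha>' \<beta>')
    show ?thesis
    proof (cases "\<beta> = \<beta>'")
      case False
      define t where "t = (\<alpha>' - \<alpha>) / (\<beta> - \<beta>')"
      have "\<alpha> + \<beta> * t = \<alpha>' + \<beta>' * t"
        using False by (simp add: t_def divide_simps) (simp add: algebra_simps)
      then have "m = Ln \<alpha> \<beta>"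
        by (intro affine_parallel_meet_eq[OF assms par', of "pt (\<alpha> + \<beta> * t) t"])
          (use Ln in auto)
      then show ?thesis by blast
    qed (use Ln in blast)
  qed
qed (auto simp: parallel_Ln)

end

text \<open>With \<open>q - p\<close> as second vector, \<open>q\<close> has coordinates (0, 1) and
  thus height 1 in the model.\<close>

lemma frame_exists:
  assumes "is_line l" "p \<in> l" "q \<notin> l"
  obtains v where "frame v (q - p)" "l = frame.Hz p v (q - p) 0"
proof -
  obtain v where v: "v \<noteq> 0" "l = range (\<lambda>r. p + r *\<^sub>R v)"
    using is_line_param assms by metis
  define w where "w = q - p"
  have fr: "frame v w"
  proof
    show "v $ 1 * w $ 2 - v $ 2 * w $ 1 \<noteq> 0"
    proof
      assume 0: "v $ 1 * w $ 2 - v $ 2 * w $ 1 = 0"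
      have "\<exists>r. w = r *\<^sub>R v"
      proof (cases "v $ 1 = 0")
        case True
        then have "v $ 2 \<noteq> 0" using v(1) by (auto simp: vec_eq_iff forall_2)
        then have "w = (w $ 2 / v $ 2) *\<^sub>R v"
          using 0 True by (simp add: vec_eq_iff forall_2)
        then show ?thesis by blast
      next
        case False
        then have "w = (w $ 1 / v $ 1) *\<^sub>R v"
          using 0 by (simp add: vec_eq_iff forall_2 field_simps)
        then show ?thesis by blast
      qed
      then obtain r where "q = p + r *\<^sub>R v" by (auto simp: w_def algebra_simps)
      then show False using v assms(3) by blast
    qed
  qed
  moreover have "l = frame.Hz p v w 0"
    unfolding frame.Hz_def[OF fr] frame.pt_def[OF fr] v(2) by simp
  ultimately show ?thesis using that w_def by blast
qed

lemma nonparallel_meet: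
  assumes "is_line l" "is_line m" "\<not> affine_parallel l m"
  obtains p where "p \<in> l" "p \<in> m"
proof -
  obtain p where p: "p \<in> l" using is_line_nonempty assms by blast
  have "l \<noteq> UNIV" using assms(1) by (auto simp: is_line_def)
  then obtain q where q: "q \<notin> l" by blast
  obtain v where v: "frame v (q - p)" "l = frame.Hz p v (q - p) 0"
    using frame_exists[OF assms(1) p q] by blast
  interpret frame p v "q - p" by (rule v(1))
  show ?thesis
  using assms(2)
  proof (cases rule: line_cases)
    case (Hz t)
    then show ?thesis using parallel_Hz[of 0 t] assms(3) v(2) by simp
  next
    case (Ln \<alpha> \<beta>)
    then show ?thesis using that[of "pt \<alpha> 0"] v(2) by simp
  qed
qed

section \<open>Arrangements without ordinary vertices and their half-plane models\<close>

locale arrangement =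
  fixes \<A> :: "(real^2) set set"
  assumes lines: "\<And>l. l \<in> \<A> \<Longrightarrow> is_line l"
    and locally_finite: "locally_finite_lines \<A>"
    and no_ordinary: "\<And>p. \<not> ordinary_vertex \<A> p"
begin

lemma finite_meeting: "finite {l \<in> \<A>. l \<inter> cball c r \<noteq> {}}"
  using locally_finite by (simp add: locally_finite_lines_def)

lemma third_line:
  assumes "l \<in> \<A>" "m \<in> \<A>" "l \<noteq> m" "p \<in> l" "p \<in> m"
  obtains k where "k \<in> \<A>" "p \<in> k" "k \<noteq> l" "k \<noteq> m"
proof (rule ccontr)
  assume "\<not> thesis"
  then have "lines_through \<A> p = {l, m}"
    using assms that by (auto simp: lines_through_def)
  then have "ordinary_vertex \<A> p"
    using assms(3) by (auto simp: ordinary_vertex_def is_vertex_def)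
  then show False using no_ordinary by blast
qed

lemma is_vertexI: "\<lbrakk>l \<in> \<A>; m \<in> \<A>; l \<noteq> m; p \<in> l; p \<in> m\<rbrakk> \<Longrightarrow> is_vertex \<A> p"
  by (auto simp: is_vertex_def lines_through_def)

lemma is_vertexE:
  assumes "is_vertex \<A> p"
  obtains l m where "l \<in> \<A>" "m \<in> \<A>" "l \<noteq> m" "p \<in> l" "p \<in> m"
  using assms by (auto simp: is_vertex_def lines_through_def)

end

locale framed_arrangement = arrangement \<A> + frame orig v w
  for \<A> orig v w +
  assumes base: "Hz 0 \<in> \<A>"
begin

text \<open>
  The base line \<open>t = 0\<close> is sent to infinity by \<open>x = s / t\<close>, \<open>y = 1 / t\<close>: a line crossing it at
  \<open>\<alpha>\<close> with slope \<open>\<beta>\<close> becomes \<open>x = \<alpha> y + \<beta>\<close>, so lines through a common point of the base become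
  parallel, and lines parallel to the base become horizontal.
\<close>

definition N :: "(real \<times> real) set" where "N = {n. Ln (fst n) (snd n) \<in> \<A>}"
definition H :: "real set" where "H = {y. 0 < y \<and> Hz (1 / y) \<in> \<A>}"

text \<open>The point comes from inverting \<open>x = s / t\<close>,
  \<open>y = 1 / t\<close>.\<close>

lemma Ln_at:
  assumes "0 < y"
  shows "pt (xat n y / y) (1 / y) \<in> Ln (fst m) (snd m) \<longleftrightarrow> xat m y = xat n y"
  using assms by (auto simp: xat_def field_simps)

lemma line_at:
  assumes "k \<in> \<A>" "0 < y" "pt (xat n y / y) (1 / y) \<in> k"
  shows "(y \<in> H \<and> k = Hz (1 / y)) \<or> (\<exists>m\<in>N. k = Ln (fst m) (snd m) \<and> xat m y = xat n y)"
using lines[OF assms(1)]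
  proof (cases rule: line_cases)
  case (Hz t)
  then show ?thesis using assms by (auto simp: H_def)
next
  case (Ln \<alpha> \<beta>)
  then show ?thesis
    using assms Ln_at[of y n "(\<alpha>, \<beta>)"] by (auto simp: N_def intro!: bexI[of _ "(\<alpha>, \<beta>)"])
qed

sublocale upper_model N H
proof
  fix T R
  let ?S = "{n \<in> N. \<exists>t. 0 \<le> t \<and> t \<le> T \<and> \<bar>fst n + snd n * t\<bar> \<le> R}"
  \<comment> \<open>By the triangle inequality this disc contains the box \<open>|s| <= R\<close>,
    \<open>0 <= t <= T\<close>.\<close>
  let ?B = "cball orig (R * norm v + T * norm w)"
  have inj: "inj_on (\<lambda>n. Ln (fst n) (snd n)) ?S"
    by (auto simp: inj_on_def prod_eq_iff)
  have "(\<lambda>n. Ln (fst n) (snd n)) ` ?S \<subseteq> {l \<in> \<A>. l \<inter> ?B \<noteq> {}}"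
  proof
    fix k assume "k \<in> (\<lambda>n. Ln (fst n) (snd n)) ` ?S"
    then obtain n t where n: "n \<in> N" "0 \<le> t" "t \<le> T" "\<bar>fst n + snd n * t\<bar> \<le> R"
      and k: "k = Ln (fst n) (snd n)" by auto
    let ?p = "pt (fst n + snd n * t) t"
    have "dist orig ?p = norm ((fst n + snd n * t) *\<^sub>R v + t *\<^sub>R w)"
      by (subst dist_commute) (simp add: pt_def dist_norm add.assoc)
    also have "\<dots> \<le> \<bar>fst n + snd n * t\<bar> * norm v + \<bar>t\<bar> * norm w"
      by (rule order_trans[OF norm_triangle_ineq]) simp
    also have "\<dots> \<le> R * norm v + T * norm w"
      using n by (intro add_mono mult_right_mono) auto
    finally have "?p \<in> k \<inter> ?B"
      by (simp add: k)
    then have "k \<inter> ?B \<noteq> {}" by blast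
    then show "k \<in> {l \<in> \<A>. l \<inter> ?B \<noteq> {}}"
      using n(1) k by (simp add: N_def)
  qed
  then show "finite ?S"
    using finite_meeting inj by (meson finite_imageD finite_subset)
next
  fix n assume n: "n \<in> N"
  \<comment> \<open>A third line through this vertex of the base is not parallel to the base, so it
    is the required twin.\<close>
  obtain k where k: "k \<in> \<A>" "pt (fst n) 0 \<in> k" "k \<noteq> Ln (fst n) (snd n)" "k \<noteq> Hz 0"
    using third_line[OF _ base, of "Ln (fst n) (snd n)" "pt (fst n) 0"] n by (auto simp: N_def)
  show "\<exists>n'\<in>N. fst n' = fst n \<and> snd n' \<noteq> snd n"
  using lines[OF k(1)]
  proof (cases rule: line_cases)
    case (Ln \<alpha> \<beta>)
    then show ?thesis
      using k by (auto simp: N_def intro!: bexI[of _ "(\<alpha>, \<beta>)"])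
  qed (use k in auto)
next
  fix n m y assume n: "n \<in> N" "m \<in> N" "n \<noteq> m" "0 < y" "xat n y = xat m y"
  let ?p = "pt (xat n y / y) (1 / y)"
  have A: "Ln (fst n) (snd n) \<in> \<A>" "Ln (fst m) (snd m) \<in> \<A>"
    using n by (auto simp: N_def)
  have ne: "Ln (fst n) (snd n) \<noteq> Ln (fst m) (snd m)"
    using n(3) by (simp add: prod_eq_iff)
  have "?p \<in> Ln (fst n) (snd n)" "?p \<in> Ln (fst m) (snd m)"
    unfolding Ln_at[OF n(4)] using n(5) by simp_all
  then obtain k where k: "k \<in> \<A>" "?p \<in> k" "k \<noteq> Ln (fst n) (snd n)" "k \<noteq> Ln (fst m) (snd m)"
    using third_line[OF A ne] by blast
  show "y \<in> H \<or> (\<exists>k\<in>N. k \<noteq> n \<and> k \<noteq> m \<and> xat k y = xat n y)"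
    using line_at[OF k(1) n(4) k(2)] k(3,4) by metis
next
  fix n y assume n: "n \<in> N" "y \<in> H"
  then have y: "0 < y" "Hz (1 / y) \<in> \<A>" by (auto simp: H_def)
  let ?p = "pt (xat n y / y) (1 / y)"
  have A: "Ln (fst n) (snd n) \<in> \<A>"
    using n by (auto simp: N_def)
  have "?p \<in> Ln (fst n) (snd n)"
    unfolding Ln_at[OF y(1)] by simp
  then obtain k where k: "k \<in> \<A>" "?p \<in> k" "k \<noteq> Ln (fst n) (snd n)" "k \<noteq> Hz (1 / y)"
    using third_line[OF A y(2) Hz_neq_Ln(2), of ?p] by auto
  show "\<exists>k\<in>N. k \<noteq> n \<and> xat k y = xat n y"
    using line_at[OF k(1) y(1) k(2)] k(3,4) by metis
qed (simp add: H_def)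

end

section \<open>Neighbouring vertices and the number of lines through a vertex\<close>

context arrangement
begin

text \<open>With \<open>l\<close> at infinity, \<open>a\<close> becomes \<open>x = 0\<close>, and
  its points above height 1 are those strictly between \<open>p\<close> and \<open>q\<close>. None
  of them is a vertex, so \<open>q\<close> is topmost on \<open>a\<close>.\<close>

lemma adjacent_parallel:
  assumes l: "l \<in> \<A>" "p \<in> l" and a: "a \<in> \<A>" "p \<in> a" "q \<in> a" and "l \<noteq> a" "q \<noteq> p"
    and q: "is_vertex \<A> q" and gap: "\<And>r. r \<in> open_segment p q \<Longrightarrow> \<not> is_vertex \<A> r"
  obtains h where "h \<in> \<A>" "q \<in> h" "affine_parallel l h"
proof -
  have ql: "q \<notin> l"
    using is_line_eqI[OF lines[OF l(1)] lines[OF a(1)] l(2) a(2)] a assms(6,7) by metis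
  obtain v where v: "frame v (q - p)" "l = frame.Hz p v (q - p) 0"
    using frame_exists[OF lines[OF l(1)] l(2) ql] by blast
  interpret frame p v "q - p" by (rule v(1))
  interpret framed_arrangement \<A> p v "q - p"
    by unfold_locales (use l v in simp)
  have q_in: "q \<in> Hz t \<longleftrightarrow> t = 1" "q \<in> Ln \<alpha> \<beta> \<longleftrightarrow> \<alpha> + \<beta> = 0" for t \<alpha> \<beta>
    using orig_plus_in by simp_all
  have q_pt: "pt (xat (0, 0) 1 / 1) (1 / 1) = q"
    using pt_0_1 by (simp add: xat_def)
  have aL: "a = Ln 0 0"
  using lines[OF a(1)]
  proof (cases rule: line_cases)
    case (Hz t)
    then show ?thesis using a(2,3) q_in by simp
  next
    case (Ln \<alpha> \<beta>)
    then show ?thesis using a(2,3) q_in by simp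
  qed
  have aN: "(0, 0) \<in> N" using a aL by (simp add: N_def)
  have "1 \<in> H"
  proof (rule ccontr)
    assume nH: "1 \<notin> H"
    obtain k where k: "k \<in> \<A>" "q \<in> k" "k \<noteq> a"
      using q by (metis is_vertexE)
    have "\<exists>m\<in>N. k = Ln (fst m) (snd m) \<and> xat m 1 = xat (0, 0) 1"
      using line_at[OF k(1), of 1 "(0, 0)"] k(2) nH unfolding q_pt by simp
    then have 1: "1 \<in> V (0, 0)"
      using k(3) aL by (auto simp: V_def)
    have "y' \<le> 1" if y': "y' \<in> V (0, 0)" for y'
    proof (rule ccontr)
      assume gt: "\<not> y' \<le> 1"
      obtain m where m: "m \<in> N" "m \<noteq> (0, 0)" "xat m y' = xat (0, 0) y'"
        using y' by (auto simp: V_def)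
      let ?r = "pt (xat (0, 0) y' / y') (1 / y')"
      have "?r \<in> Ln (fst m) (snd m)"
        using Ln_at[of y' "(0, 0)" m] m gt by simp
      moreover have "?r \<in> a"
        using gt by (simp add: aL xat_def)
      moreover have "Ln (fst m) (snd m) \<noteq> a"
        using m(2) by (auto simp: aL prod_eq_iff)
      ultimately have "is_vertex \<A> ?r"
        using m(1) a(1) by (intro is_vertexI[of "Ln (fst m) (snd m)" a]) (auto simp: N_def)
      moreover have "?r \<in> open_segment p q"
        unfolding in_segment using gt assms(7)
        by (simp add: pt_def xat_def) (rule exI[of _ "1 / y'"], simp add: algebra_simps)
      ultimately show False using gap by blast
    qed
    then show False using top_horizontal[OF aN 1] nH by blast
  qed
  then have "Hz 1 \<in> \<A>" by (simp add: H_def)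
  moreover have "q \<in> Hz 1" by (simp add: q_in)
  moreover have "affine_parallel l (Hz 1)" using v(2) parallel_Hz by simp
  ultimately show ?thesis using that by blast
qed

text \<open>The lines through \<open>p\<close> other than a base \<open>l\<close> form the class
  with \<open>fst = 0\<close>; \<open>twin\<close> and \<open>parallel_at_most_two\<close> bound its
  size from both sides. The vertex \<open>q\<close> provides a crossing in the open half plane; with
  a single vertex, concurrent families refute the claim.\<close>

lemma card_lines_through:
  assumes p: "is_vertex \<A> p" and q: "is_vertex \<A> q" and "q \<noteq> p"
  shows "card (lines_through \<A> p) = 3"
proof -
  \<comment> \<open>At most one line contains both \<open>p\<close> and \<open>q\<close>, so one of
    two lines through \<open>p\<close> misses \<open>q\<close>.\<close>
  obtain l l2 where l: "l \<in> \<A>" "p \<in> l" "q \<notin> l" and l2: "l2 \<in> \<A>" "p \<in> l2" "l2 \<noteq> l"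
    using p is_line_eqI[OF lines lines, of _ _ p q] assms(3) by (metis is_vertexE)
  obtain v where v: "frame v (q - p)" "l = frame.Hz p v (q - p) 0"
    using frame_exists[OF lines[OF l(1)] l(2,3)] by blast
  interpret frame p v "q - p" by (rule v(1))
  interpret framed_arrangement \<A> p v "q - p"
    by unfold_locales (use l v in simp)
  have q_in: "q \<in> Hz t \<longleftrightarrow> t = 1" "q \<in> Ln \<alpha> \<beta> \<longleftrightarrow> \<alpha> + \<beta> = 0" for t \<alpha> \<beta>
    using orig_plus_in by simp_all
  have q_pt: "pt (xat (0, 0) 1 / 1) (1 / 1) = q"
    using pt_0_1 by (simp add: xat_def)
  have through_p: "k = Hz 0 \<or> (\<exists>\<beta>. (0, \<beta>) \<in> N \<and> k = Ln 0 \<beta>)" if "k \<in> \<A>" "p \<in> k" for k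
  using lines[OF that(1)]
  proof (cases rule: line_cases)
    case (Hz t)
    then show ?thesis using that(2) by simp
  next
    case (Ln \<alpha> \<beta>)
    then show ?thesis using that by (auto simp: N_def)
  qed
  obtain m where m: "m \<in> N" "V m \<noteq> {}"
  proof -
    obtain k1 k2 where k: "k1 \<in> \<A>" "k2 \<in> \<A>" "k1 \<noteq> k2" "q \<in> k1" "q \<in> k2"
      using q by (rule is_vertexE)
    obtain k3 where k3: "k3 \<in> \<A>" "q \<in> k3" "k3 \<noteq> k1" "k3 \<noteq> k2"
      using third_line[OF k] by metis
    \<comment> \<open>Of three lines through \<open>q\<close> at most one is horizontal, so two
      lines of \<open>N\<close> cross at height 1.\<close>
    obtain n1 n2 where n: "n1 \<in> {k1, k2, k3}" "n2 \<in> {k1, k2, k3}" "n1 \<noteq> n2" "n1 \<noteq> Hz 1" "n2 \<noteq> Hz 1"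
    proof (cases "k1 = Hz 1")
      case True
      then show ?thesis using that[of k2 k3] k k3 by auto
    next
      case False
      then show ?thesis using that[of k1 k2] that[of k1 k3] k k3 by (cases "k2 = Hz 1") auto
    qed
    have "\<exists>m\<in>N. j = Ln (fst m) (snd m) \<and> xat m 1 = xat (0, 0) 1" if "j \<in> {k1, k2, k3}" "j \<noteq> Hz 1" for j
    proof -
      have "j \<in> \<A>" "q \<in> j" using that k k3 by auto
      then show ?thesis
        using line_at[of j 1 "(0, 0)"] that(2) unfolding q_pt by simp
    qed
    then obtain m1 m2 where "m1 \<in> N" "m2 \<in> N" "n1 = Ln (fst m1) (snd m1)" "n2 = Ln (fst m2) (snd m2)"
      "xat m1 1 = xat (0, 0) 1" "xat m2 1 = xat (0, 0) 1"
      using n by metis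
    then have "1 \<in> V m1" using n(3) by (auto simp: V_def)
    then show ?thesis using that \<open>m1 \<in> N\<close> by blast
  qed
  obtain \<beta>1 where b1: "(0, \<beta>1) \<in> N" "l2 = Ln 0 \<beta>1"
    using through_p[OF l2(1,2)] l2(3) v(2) by auto
  obtain \<beta>2 where b2: "(0, \<beta>2) \<in> N" "\<beta>2 \<noteq> \<beta>1"
    using twin[OF b1(1)] by auto
  have "\<beta> = \<beta>1 \<or> \<beta> = \<beta>2" if "(0, \<beta>) \<in> N" for \<beta>
  proof (rule ccontr)
    assume "\<not> ?thesis"
    then consider "\<beta> < \<beta>1" "\<beta>1 < \<beta>2" | "\<beta> < \<beta>2" "\<beta>2 < \<beta>1" | "\<beta>1 < \<beta>" "\<beta> < \<beta>2"
      | "\<beta>1 < \<beta>2" "\<beta>2 < \<beta>" | "\<beta>2 < \<beta>" "\<beta> < \<beta>1" | "\<beta>2 < \<beta>1" "\<beta>1 < \<beta>"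
      using b2(2) by linarith
    then show False
      using parallel_at_most_two[OF m, of "(0, \<beta>)" "(0, \<beta>1)" "(0, \<beta>2)"]
        parallel_at_most_two[OF m, of "(0, \<beta>)" "(0, \<beta>2)" "(0, \<beta>1)"]
        parallel_at_most_two[OF m, of "(0, \<beta>1)" "(0, \<beta>)" "(0, \<beta>2)"]
        parallel_at_most_two[OF m, of "(0, \<beta>1)" "(0, \<beta>2)" "(0, \<beta>)"]
        parallel_at_most_two[OF m, of "(0, \<beta>2)" "(0, \<beta>)" "(0, \<beta>1)"]
        parallel_at_most_two[OF m, of "(0, \<beta>2)" "(0, \<beta>1)" "(0, \<beta>)"]
        that b1 b2 by cases simp_all
  qed
  then have "lines_through \<A> p \<subseteq> {Hz 0, Ln 0 \<beta>1, Ln 0 \<beta>2}"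
    using through_p by (auto simp: lines_through_def)
  moreover have "{Hz 0, Ln 0 \<beta>1, Ln 0 \<beta>2} \<subseteq> lines_through \<A> p"
    using b1 b2 base by (auto simp: lines_through_def N_def)
  ultimately have "lines_through \<A> p = {Hz 0, Ln 0 \<beta>1, Ln 0 \<beta>2}"
    by blast
  then show ?thesis using b2(2) by simp
qed

end

subsection \<open>All vertices have the same directions\<close>

text \<open>Division with remainder by the least positive element \<open>c\<close>: the remainder is
  in \<open>X\<close>, nonnegative and below \<open>c\<close>, hence zero.\<close>

lemma discrete_additive_subgroup:
  fixes X :: "real set"
  assumes diff: "\<And>x y. \<lbrakk>x \<in> X; y \<in> X\<rbrakk> \<Longrightarrow> x - y \<in> X"
    and fin: "\<And>R. finite {x \<in> X. \<bar>x\<bar> \<le> R}"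
    and x0: "x0 \<in> X" "x0 \<noteq> 0"
  obtains c where "0 < c" "X = range (\<lambda>n::int. of_int n * c)"
proof -
  have zero: "0 \<in> X" using diff[OF x0(1) x0(1)] by simp
  have neg: "- x \<in> X" if "x \<in> X" for x using diff[OF zero that] by simp
  have add: "x + y \<in> X" if "x \<in> X" "y \<in> X" for x y
    using diff[OF that(1) neg[OF that(2)]] by simp
  define P where "P = {x \<in> X. 0 < x \<and> x \<le> \<bar>x0\<bar>}"
  have finP: "finite P"
    by (rule finite_subset[OF _ fin[of "\<bar>x0\<bar>"]]) (auto simp: P_def)
  have "\<bar>x0\<bar> \<in> P" using x0 neg by (auto simp: P_def abs_if)
  then have "Min P \<in> P" using finP Min_in by blast
  define c where "c = Min P"
  have c: "c \<in> X" "0 < c" "c \<le> \<bar>x0\<bar>"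
    using \<open>Min P \<in> P\<close> by (auto simp: P_def c_def)
  have min: "c \<le> x" if "x \<in> X" "0 < x" for x
  proof (cases "x \<le> \<bar>x0\<bar>")
    case True
    then show ?thesis using that finP by (auto simp: c_def P_def)
  qed (use c in simp)
  have mult: "of_int n * c \<in> X" for n :: int
  proof (induction n rule: int_induct[where k = 0])
    case base
    then show ?case using zero by simp
  next
    case (step1 i)
    then show ?case using add[OF _ c(1), of "of_int i * c"] by (simp add: algebra_simps)
  next
    case (step2 i)
    then show ?case using diff[OF _ c(1), of "of_int i * c"] by (simp add: algebra_simps)
  qed
  have "x \<in> range (\<lambda>n::int. of_int n * c)" if x: "x \<in> X" for x
  proof -
    define r where "r = x - of_int \<lfloor>x / c\<rfloor> * c"
    have r: "r \<in> X" unfolding r_def using diff x mult by blast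
    define k where "k = real_of_int \<lfloor>x / c\<rfloor>"
    have "k \<le> x / c" "x / c < k + 1"
      unfolding k_def by linarith+
    then have "0 \<le> r" "r < c"
      using c(2) unfolding r_def k_def[symmetric] by (simp_all add: field_simps)
    then have "r = 0" using min[OF r] by linarith
    then show ?thesis by (auto simp: r_def)
  qed
  then have "X = range (\<lambda>n::int. of_int n * c)" using mult by blast
  then show ?thesis using that c(2) by blast
qed

context frame
begin

lemma linear_crd: "linear (\<lambda>p. crd1 (orig + p))" "linear (\<lambda>p. crd2 (orig + p))"
  unfolding crd1_def crd2_def
  by (auto intro!: linearI simp: algebra_simps add_divide_distrib diff_divide_distrib)

text \<open>The divisor \<open>c\<close> will be the spacing of the lines, which becomes 1.\<close>

definition chart :: "real \<Rightarrow> real^2 \<Rightarrow> real^2" where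
  "chart c p = vector [crd1 p / c, crd2 p / c]"

lemma affine_map_chart: "affine_map (chart c)"
proof -
  define L :: "real^2 \<Rightarrow> real^2" where
    "L = (\<lambda>p. vector [crd1 (orig + p) / c, crd2 (orig + p) / c])"
  have "linear L"
    unfolding L_def
    by (rule linearI)
      (simp_all add: vec_eq_iff forall_2 linear_add[OF linear_crd(1)] linear_add[OF linear_crd(2)]
        linear_scale[OF linear_crd(1)] linear_scale[OF linear_crd(2)] add_divide_distrib)
  moreover have "chart c p = L p + - L orig" for p
  proof -
    have "chart c p = L (p - orig)" by (simp add: chart_def L_def)
    also have "\<dots> = L p - L orig" using \<open>linear L\<close> by (rule linear_diff)
    finally show ?thesis by simp
  qed
  ultimately show ?thesis unfolding affine_map_def by blast
qed

lemma in_chart_image: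
  assumes "c \<noteq> 0"
  shows "x \<in> chart c ` S \<longleftrightarrow> pt (c * x $ 1) (c * x $ 2) \<in> S"
proof
  assume "x \<in> chart c ` S"
  then obtain p where p: "p \<in> S" "x = chart c p" by blast
  have "pt (c * x $ 1) (c * x $ 2) = p"
    using assms by (simp add: p(2) chart_def)
  then show "pt (c * x $ 1) (c * x $ 2) \<in> S" using p by simp
next
  assume "pt (c * x $ 1) (c * x $ 2) \<in> S"
  moreover have "x = chart c (pt (c * x $ 1) (c * x $ 2))"
    using assms by (simp add: chart_def vec_eq_iff forall_2)
  ultimately show "x \<in> chart c ` S" by blast
qed

lemma chart_images:
  assumes "c \<noteq> 0"
  shows "chart c ` Hz t = {p. p $ 2 = t / c}"
    and "chart c ` Ln s 0 = {p. p $ 1 = s / c}"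
    and "chart c ` Ln s (-1) = {p. p $ 1 + p $ 2 = s / c}"
  unfolding set_eq_iff in_chart_image[OF assms] using assms by (simp_all add: field_simps)

end

context arrangement
begin

text \<open>One inclusion suffices as a definition, since it is proved for all ordered pairs of
  vertices.\<close>

definition same_directions :: "real^2 \<Rightarrow> real^2 \<Rightarrow> bool" where
  "same_directions p q \<longleftrightarrow> (\<forall>l\<in>\<A>. p \<in> l \<longrightarrow> (\<exists>h\<in>\<A>. q \<in> h \<and> affine_parallel l h))"

lemma same_directions_trans:
  "\<lbrakk>same_directions p q; same_directions q r\<rbrakk> \<Longrightarrow> same_directions p r"
  unfolding same_directions_def by (meson affine_parallel_assoc)

text \<open>Each such vertex is the only common point of \<open>a\<close> with some other line
  meeting a fixed disc around \<open>p\<close>.\<close>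

lemma finite_vertices_segment:
  assumes "a \<in> \<A>" "p \<in> a" "q \<in> a"
  shows "finite {r \<in> open_segment p q. is_vertex \<A> r}"
proof -
  let ?F = "{l \<in> \<A>. l \<inter> cball p (dist p q) \<noteq> {}} - {a}"
  have "{r \<in> open_segment p q. is_vertex \<A> r} \<subseteq> (\<Union>k\<in>?F. a \<inter> k)"
  proof
    fix r assume "r \<in> {r \<in> open_segment p q. is_vertex \<A> r}"
    then have r: "r \<in> open_segment p q" "is_vertex \<A> r" by auto
    have "r \<in> affine hull {p, q}"
      using r(1) segment_open_subset_closed convex_hull_subset_affine_hull[of "{p, q}"]
      by (auto simp: segment_convex_hull)
    moreover have "affine hull {p, q} \<subseteq> a"
      using assms lines by (simp add: hull_minimal is_line_def)
    ultimately have ra: "r \<in> a" by blast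
    have "r \<in> cball p (dist p q)"
      using r(1) dist_in_open_segment[of r p q] by (auto simp: dist_commute)
    moreover obtain k where "k \<in> \<A>" "r \<in> k" "k \<noteq> a"
      using r(2) by (metis is_vertexE)
    ultimately show "r \<in> (\<Union>k\<in>?F. a \<inter> k)" using ra by blast
  qed
  moreover have "finite (\<Union>k\<in>?F. a \<inter> k)"
  proof (rule finite_UN_I)
    show "finite ?F" using finite_meeting by blast
    fix k assume k: "k \<in> ?F"
    have "x = y" if "x \<in> a \<inter> k" "y \<in> a \<inter> k" for x y
      using is_line_eqI[OF lines lines, of a k x y] k that assms(1) by blast
    then show "finite (a \<inter> k)"
      by (metis finite.emptyI finite_insert insertI1 subsetI equals0I finite_subset singletonI)
  qed
  ultimately show ?thesis using finite_subset by blast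
qed

text \<open>Induction on the number of vertices strictly between: an intermediate one splits the
  segment, and neighbours are settled by \<open>adjacent_parallel\<close>.\<close>

lemma same_directions_on_line:
  assumes "a \<in> \<A>" "p \<in> a" "q \<in> a" "is_vertex \<A> p" "is_vertex \<A> q"
  shows "same_directions p q"
  using assms
proof (induction "card {r \<in> open_segment p q. is_vertex \<A> r}" arbitrary: p q rule: less_induct)
  case less
  note fin = finite_vertices_segment[OF less.prems(1-3)]
  show ?case
  proof (cases "{r \<in> open_segment p q. is_vertex \<A> r} = {}")
    case True
    show ?thesis
      unfolding same_directions_def
    proof (intro ballI impI)
      fix l assume l: "l \<in> \<A>" "p \<in> l"
      show "\<exists>h\<in>\<A>. q \<in> h \<and> affine_parallel l h"
      proof (cases "l = a \<or> q = p")
        case True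
        then show ?thesis using affine_parallel_reflex less.prems l by blast
      next
        case False
        then show ?thesis
          using adjacent_parallel[OF l less.prems(1-3) _ _ less.prems(5)] True by blast
      qed
    qed
  next
    case False
    then obtain r where r: "r \<in> open_segment p q" "is_vertex \<A> r" by blast
    have rin: "r \<in> a"
    proof -
      have "r \<in> affine hull {p, q}"
        using r(1) segment_open_subset_closed convex_hull_subset_affine_hull[of "{p, q}"]
        by (auto simp: segment_convex_hull)
      moreover have "affine hull {p, q} \<subseteq> a"
        using less.prems lines by (simp add: hull_minimal is_line_def)
      ultimately show ?thesis by blast
    qed
    have sub: "open_segment p r \<subseteq> open_segment p q" "open_segment r q \<subseteq> open_segment p q"
      using r(1) by (auto simp: subset_open_segment open_closed_segment)
    have "r \<notin> open_segment p r" "r \<notin> open_segment r q"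
      by (simp_all add: open_segment_def)
    then have "card {x \<in> open_segment p r. is_vertex \<A> x} < card {x \<in> open_segment p q. is_vertex \<A> x}"
      "card {x \<in> open_segment r q. is_vertex \<A> x} < card {x \<in> open_segment p q. is_vertex \<A> x}"
      using sub r by (auto intro!: psubset_card_mono[OF fin])
    then show ?thesis
      using less.hyps[OF _ less.prems(1,2) rin less.prems(4) r(2)]
        less.hyps[OF _ less.prems(1) rin less.prems(3) r(2) less.prems(5)]
        same_directions_trans by blast
  qed
qed

lemma not_parallel:
  assumes "l \<in> \<A>" "m \<in> \<A>" "l \<noteq> m" "p \<in> l" "p \<in> m"
  shows "\<not> affine_parallel l m"
  using affine_parallel_meet_eq[OF lines] assms by metis

text \<open>Two lines suffice to join the vertices: one of two lines through \<open>q\<close> is not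
  parallel to a chosen line through \<open>p\<close>, and they meet in a vertex
  \<open>r\<close>.\<close>

lemma same_directions:
  assumes "is_vertex \<A> p" "is_vertex \<A> q"
  shows "same_directions p q"
proof -
  obtain m where m: "m \<in> \<A>" "p \<in> m" using assms(1) by (rule is_vertexE)
  obtain n1 n2 where n: "n1 \<in> \<A>" "n2 \<in> \<A>" "n1 \<noteq> n2" "q \<in> n1" "q \<in> n2"
    using assms(2) by (rule is_vertexE)
  have "\<not> affine_parallel n1 n2" using not_parallel n by blast
  then have "\<not> affine_parallel n1 m \<or> \<not> affine_parallel m n2"
    using affine_parallel_assoc by blast
  then obtain n where n: "n \<in> \<A>" "q \<in> n" "\<not> affine_parallel n m"
    using n affine_parallel_commute by blast
  then obtain r where r: "r \<in> n" "r \<in> m"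
    using nonparallel_meet lines m by metis
  have "n \<noteq> m" using n(3) affine_parallel_reflex by blast
  then have "is_vertex \<A> r" using is_vertexI n m r by blast
  then show ?thesis
    using same_directions_on_line[OF m r(2)] same_directions_on_line[OF n(1) r(1) n(2)] assms
      same_directions_trans by blast
qed

theorem affinely_triangular_of_nonparallel_nonconcurrent:
  assumes np: "\<not> all_parallel \<A>" and nc: "\<not> concurrent \<A>"
  shows "affinely_triangular \<A>"
proof -
  obtain l0 m0 where lm0: "l0 \<in> \<A>" "m0 \<in> \<A>" "\<not> affine_parallel l0 m0"
    using np by (auto simp: all_parallel_def)
  have has_vertex: "\<exists>p. p \<in> k \<and> is_vertex \<A> p" if k: "k \<in> \<A>" for k
  proof -
    obtain m where m: "m \<in> \<A>" "\<not> affine_parallel k m"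
      using lm0 affine_parallel_assoc affine_parallel_commute by metis
    then obtain p where "p \<in> k" "p \<in> m" using nonparallel_meet lines k by metis
    then show ?thesis using is_vertexI k m affine_parallel_reflex by metis
  qed
  obtain orig where orig: "is_vertex \<A> orig" using has_vertex lm0 by blast
  \<comment> \<open>A line missing \<open>orig\<close> carries a second vertex, as
    \<open>card_lines_through\<close> requires.\<close>
  obtain k where k: "k \<in> \<A>" "orig \<notin> k" using nc by (auto simp: concurrent_def)
  then obtain q where q: "is_vertex \<A> q" "q \<noteq> orig" using has_vertex by blast
  have "card (lines_through \<A> orig) = 3"
    by (rule card_lines_through[OF orig q])
  then obtain l b d where lbd: "lines_through \<A> orig = {l, b, d}" and ne: "l \<noteq> b" "l \<noteq> d" "b \<noteq> d"
    by (auto simp: card_3_iff)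
  have A: "l \<in> \<A>" "b \<in> \<A>" "d \<in> \<A>" and O: "orig \<in> l" "orig \<in> b" "orig \<in> d"
    using lbd by (auto simp: lines_through_def)
  obtain b0 where b0: "b0 \<noteq> 0" "b = range (\<lambda>r. orig + r *\<^sub>R b0)"
    using is_line_param[OF lines[OF A(2)] O(2)] by blast
  define q0 where "q0 = orig + b0"
  have q0b: "q0 \<in> b" unfolding b0(2) q0_def by (rule image_eqI[of _ _ 1]) simp_all
  have "q0 \<notin> l"
    using is_line_eqI[OF lines[OF A(1)] lines[OF A(2)] O(1,2) _ q0b] ne(1) b0(1) by (auto simp: q0_def)
  then obtain v0 where v0: "frame v0 (q0 - orig)" "l = frame.Hz orig v0 (q0 - orig) 0"
    using frame_exists[OF lines[OF A(1)] O(1)] by blast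
  interpret F0: frame orig v0 "q0 - orig" by (rule v0(1))
  have through0: "\<exists>\<beta>. x = F0.Ln 0 \<beta>" if "x \<in> {b, d}" for x
  proof -
    have x: "x \<in> \<A>" "orig \<in> x" "x \<noteq> l" using that A O ne by auto
    show ?thesis
      using lines[OF x(1)]
    proof (cases rule: F0.line_cases)
      case (Hz t)
      then show ?thesis using x v0(2) by simp
    next
      case (Ln \<alpha> \<beta>)
      then show ?thesis using x by simp
    qed
  qed
  obtain \<beta>b where b: "b = F0.Ln 0 \<beta>b" using through0 by blast
  then have b: "b = F0.Ln 0 0" using q0b F0.orig_plus_in(2)[of 0 \<beta>b] by simp
  obtain \<beta> where d: "d = F0.Ln 0 \<beta>" using through0 by blast
  have \<beta>: "\<beta> \<noteq> 0" using b d ne by auto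
  \<comment> \<open>In the first frame \<open>d\<close> is \<open>s = \<beta> * t\<close>; this
    rescaling makes it \<open>s + t = 0\<close> and leaves \<open>l\<close> and \<open>b\<close> in
    place.\<close>
  define v where "v = (- \<beta>) *\<^sub>R v0"
  define w where "w = q0 - orig"
  have "frame v w"
  proof
    have "v $ 1 * w $ 2 - v $ 2 * w $ 1
        = - \<beta> * (v0 $ 1 * (q0 - orig) $ 2 - v0 $ 2 * (q0 - orig) $ 1)"
      by (simp add: v_def w_def algebra_simps)
    then show "v $ 1 * w $ 2 - v $ 2 * w $ 1 \<noteq> 0"
      using \<beta> F0.det by simp
  qed
  then interpret frame orig v w .
  have pt0: "F0.pt s t = pt (- s / \<beta>) t" for s t
    unfolding F0.pt_def pt_def unfolding v_def w_def using \<beta> by simp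
  have lH: "l = Hz 0"
  proof -
    have "pt 0 0 \<in> l" "pt 1 0 \<in> l"
      using F0.pt_in_Hz[of 0 0 0] F0.pt_in_Hz[of "- \<beta>" 0 0] \<beta> unfolding pt0 v0(2)[symmetric]
      by simp_all
    with lines[OF A(1)] show ?thesis
      by (cases rule: line_cases) auto
  qed
  have bL: "b = Ln 0 0"
  proof -
    have "pt 0 0 \<in> b" "pt 0 1 \<in> b"
      using F0.pt_in_Ln[of 0 0 0 0] F0.pt_in_Ln[of 0 1 0 0] unfolding pt0 b[symmetric] by simp_all
    with lines[OF A(2)] show ?thesis
      by (cases rule: line_cases) auto
  qed
  have dL: "d = Ln 0 (-1)"
  proof -
    have "pt 0 0 \<in> d" "pt (-1) 1 \<in> d"
      using F0.pt_in_Ln[of 0 0 0 \<beta>] F0.pt_in_Ln[of \<beta> 1 0 \<beta>] \<beta> unfolding pt0 d[symmetric]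
      by simp_all
    with lines[OF A(3)] show ?thesis
      by (cases rule: line_cases) auto
  qed
  define X Y Z where "X = {s. Ln s 0 \<in> \<A>}" and "Y = {t. Hz t \<in> \<A>}" and "Z = {z. Ln z (-1) \<in> \<A>}"
  have zero: "0 \<in> X" "0 \<in> Y" "0 \<in> Z"
    using A lH bL dL by (auto simp: X_def Y_def Z_def)
  \<comment> \<open>From a vertex on \<open>x\<close> its direction is carried back to
    \<open>orig\<close>, where only three directions occur.\<close>
  have all: "(\<exists>t\<in>Y. x = Hz t) \<or> (\<exists>s\<in>X. x = Ln s 0) \<or> (\<exists>z\<in>Z. x = Ln z (-1))" if x: "x \<in> \<A>" for x
  proof -
    obtain p where p: "p \<in> x" "is_vertex \<A> p" using has_vertex x by blast
    obtain h where h: "h \<in> \<A>" "orig \<in> h" "affine_parallel h x"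
      using same_directions[OF p(2) orig] p(1) x affine_parallel_commute
      unfolding same_directions_def by blast
    then have "h \<in> {Hz 0, Ln 0 0, Ln 0 (-1)}"
      using lbd lH bL dL by (auto simp: lines_through_def)
    then show ?thesis
      using h(3) x parallel_Hz_iff[OF lines[OF x]] parallel_Ln_iff[OF lines[OF x]]
      by (auto simp: X_def Y_def Z_def)
  qed
  have dirs: "t \<in> Y \<and> s \<in> X \<and> s + t \<in> Z" if "is_vertex \<A> (pt s t)" for s t
  proof -
    have sd: "\<exists>h\<in>\<A>. pt s t \<in> h \<and> affine_parallel x h" if "x \<in> {l, b, d}" for x
      using same_directions[OF orig \<open>is_vertex \<A> (pt s t)\<close>] that A O
      unfolding same_directions_def by blast
    obtain h1 where h1: "h1 \<in> \<A>" "pt s t \<in> h1" "affine_parallel (Hz 0) h1"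
      using sd lH by blast
    obtain h2 where h2: "h2 \<in> \<A>" "pt s t \<in> h2" "affine_parallel (Ln 0 0) h2"
      using sd bL by blast
    obtain h3 where h3: "h3 \<in> \<A>" "pt s t \<in> h3" "affine_parallel (Ln 0 (-1)) h3"
      using sd dL by blast
    show ?thesis
      using h1 h2 h3 parallel_Hz_iff[OF lines[OF h1(1)]] parallel_Ln_iff[OF lines[OF h2(1)]]
        parallel_Ln_iff[OF lines[OF h3(1)]]
      by (auto simp: X_def Y_def Z_def)
  qed
  \<comment> \<open>Two of the constants fix a vertex, and the third direction must occur there too.
    With 0 in all three sets, the resulting sums and differences make the sets equal.\<close>
  have XY: "s + t \<in> Z" if "s \<in> X" "t \<in> Y" for s t
  proof -
    have "is_vertex \<A> (pt s t)"
      by (rule is_vertexI[of "Ln s 0" "Hz t"]) (use that in \<open>auto simp: X_def Y_def\<close>)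
    then show ?thesis using dirs by blast
  qed
  have XZ: "z - s \<in> Y" if "s \<in> X" "z \<in> Z" for s z
  proof -
    have "is_vertex \<A> (pt s (z - s))"
      by (rule is_vertexI[of "Ln s 0" "Ln z (-1)"]) (use that in \<open>auto simp: X_def Z_def\<close>)
    then show ?thesis using dirs by blast
  qed
  have YZ: "z - t \<in> X" if "t \<in> Y" "z \<in> Z" for t z
  proof -
    have "is_vertex \<A> (pt (z - t) t)"
      by (rule is_vertexI[of "Hz t" "Ln z (-1)"]) (use that in \<open>auto simp: Y_def Z_def\<close>)
    then show ?thesis using dirs by blast
  qed
  have ZX: "Z = X"
    using YZ[OF zero(2)] XY[OF _ zero(2)] by force
  have ZY: "Z = Y"
    using XZ[OF zero(1)] XY[OF zero(1)] by force
  have diff: "x - y \<in> X" if "x \<in> X" "y \<in> X" for x y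
    using XZ[of y x] that ZX ZY by simp
  have fin: "finite {x \<in> X. \<bar>x\<bar> \<le> R}" for R
  proof -
    let ?B = "cball orig (R * norm v)"
    have "(\<lambda>s. Ln s 0) ` {x \<in> X. \<bar>x\<bar> \<le> R} \<subseteq> {l \<in> \<A>. l \<inter> ?B \<noteq> {}}"
    proof
      fix y assume "y \<in> (\<lambda>s. Ln s 0) ` {x \<in> X. \<bar>x\<bar> \<le> R}"
      then obtain s where s: "s \<in> X" "\<bar>s\<bar> \<le> R" "y = Ln s 0" by blast
      have "dist (pt s 0) orig \<le> R * norm v"
        using s(2) by (simp add: pt_def dist_norm mult_right_mono)
      then have "pt s 0 \<in> y \<inter> ?B"
        by (simp add: s(3) dist_commute)
      then have "y \<inter> ?B \<noteq> {}" by blast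
      then show "y \<in> {l \<in> \<A>. l \<inter> ?B \<noteq> {}}"
        using s by (simp add: X_def)
    qed
    then have "finite ((\<lambda>s. Ln s 0) ` {x \<in> X. \<bar>x\<bar> \<le> R})"
      using finite_meeting finite_subset by blast
    then show ?thesis
      by (rule finite_imageD) (simp add: inj_on_def)
  qed
  obtain x0 where x0: "x0 \<in> X" "x0 \<noteq> 0"
  proof -
    have "crd2 q \<in> Y" "crd1 q \<in> X"
      using dirs[of "crd1 q" "crd2 q"] q(1) by simp_all
    moreover have "crd1 q \<noteq> 0 \<or> crd2 q \<noteq> 0"
      using q(2) pt_crd[of q] pt_0_0 by metis
    ultimately show ?thesis using that ZX ZY by blast
  qed
  obtain c where c: "0 < c" "X = range (\<lambda>n::int. of_int n * c)"
    using discrete_additive_subgroup[OF diff fin x0] by blast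
  have eq: "\<A> = range (\<lambda>m::int. Ln (of_int m * c) 0) \<union> range (\<lambda>m::int. Hz (of_int m * c))
      \<union> range (\<lambda>m::int. Ln (of_int m * c) (-1))" (is "_ = ?R")
  proof
    show "\<A> \<subseteq> ?R" using all c(2) ZX ZY by blast
    have "Ln x 0 \<in> \<A>" "Hz x \<in> \<A>" "Ln x (-1) \<in> \<A>" if "x \<in> X" for x
      using that ZX ZY by (auto simp: X_def Y_def Z_def)
    then show "?R \<subseteq> \<A>" using c(2) by blast
  qed
  have c0: "c \<noteq> 0" using c(1) by simp
  have "(\<lambda>l. chart c ` l) ` \<A> = triangular_arrangement"
    unfolding eq triangular_arrangement_def image_Un image_image chart_images[OF c0]
    using c0 by simp
  then show ?thesis
    unfolding affinely_triangular_def using affine_map_chart by blast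
qed

end

subsection \<open>The triangular arrangement\<close>

text \<open>Invertibility comes for free: both axes are in the triangular arrangement, so (0, 0),
  (1, 0) and (0, 1) are values of the map. Hence its linear part is surjective, thus bijective, and
  \<open>M\<close> is its inverse.\<close>

lemma affinely_triangularE:
  assumes "affinely_triangular \<A>"
  obtains M d where "linear M" "inj M" "\<A> = (\<lambda>l. (\<lambda>x. M x + d) ` l) ` triangular_arrangement"
    "bij (\<lambda>x. M x + d)"
proof -
  obtain f L c where L: "linear L" and f: "f = (\<lambda>x. L x + c)"
    and eq: "(\<lambda>l. f ` l) ` \<A> = triangular_arrangement"
    using assms by (auto simp: affinely_triangular_def affine_map_def)
  have "t \<subseteq> range f" if "t \<in> triangular_arrangement" for t
    using that unfolding eq[symmetric] by blast
  moreover have "{p. p $ 2 = of_int 0} \<in> triangular_arrangement"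
    "{p. p $ 1 = of_int 0} \<in> triangular_arrangement"
    unfolding triangular_arrangement_def by blast+
  ultimately have range: "{p. p $ 2 = of_int 0} \<subseteq> range f" "{p. p $ 1 = of_int 0} \<subseteq> range f"
    by blast+
  have "vector [0, 0] \<in> range f" "vector [1, 0] \<in> range f" "vector [0, 1] \<in> range f"
    using range by auto
  then obtain p q r where pqr: "f p = vector [0, 0]" "f q = vector [1, 0]" "f r = vector [0, 1]"
    by (metis imageE)
  have "surj L"
  proof (rule surjI)
    fix x :: "real^2"
    have "L (q - p) = f q - f p" "L (r - p) = f r - f p"
      by (simp_all add: f linear_diff[OF L])
    then show "L ((x $ 1) *\<^sub>R (q - p) + (x $ 2) *\<^sub>R (r - p)) = x"
      by (simp only: linear_add[OF L] linear_scale[OF L] pqr) (simp add: vec_eq_iff forall_2)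
  qed
  then have "inj L" using linear_surj_imp_inj[OF L] by blast
  then obtain M where M: "linear M" "\<And>x. M (L x) = x" "\<And>x. L (M x) = x"
    using linear_injective_isomorphism[OF L] by blast
  have injM: "inj M" by (metis M(3) injI)
  define d where "d = - M c"
  define g where "g = (\<lambda>x. M x + d)"
  have gf: "g (f x) = x" for x
    by (simp add: g_def f d_def linear_add[OF M(1)] M)
  have fg: "f (g x) = x" for x
    by (simp add: g_def f d_def linear_diff[OF L] M)
  have "(\<lambda>l. g ` l) ` triangular_arrangement = \<A>"
    unfolding eq[symmetric] image_image gf by simp
  moreover have "bij g"
    by (rule bijI') (metis fg, metis gf)
  ultimately show ?thesis
    using that[of M d] M(1) injM by (simp add: g_def)
qed

lemma triangular_lines_through:
  "lines_through triangular_arrangement q =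
    {l. l = {p. p $ 1 = q $ 1} \<and> q $ 1 \<in> \<int>} \<union> {l. l = {p. p $ 2 = q $ 2} \<and> q $ 2 \<in> \<int>}
    \<union> {l. l = {p. p $ 1 + p $ 2 = q $ 1 + q $ 2} \<and> q $ 1 + q $ 2 \<in> \<int>}"
  by (auto simp: lines_through_def triangular_arrangement_def Ints_def)

lemma triangular_vertex:
  assumes "is_vertex triangular_arrangement q"
  shows "card (lines_through triangular_arrangement q) = 3"
proof -
  \<comment> \<open>A vertex satisfies two of these three conditions, and any two imply the
    third.\<close>
  have ints: "q $ 1 \<in> \<int> \<and> q $ 2 \<in> \<int> \<and> q $ 1 + q $ 2 \<in> \<int>"
    using assms Ints_diff[of "q $ 1 + q $ 2" "q $ 1"] Ints_diff[of "q $ 1 + q $ 2" "q $ 2"]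
    unfolding is_vertex_def triangular_lines_through by auto
  let ?V = "{p::real^2. p $ 1 = q $ 1}" and ?H = "{p::real^2. p $ 2 = q $ 2}"
    and ?D = "{p::real^2. p $ 1 + p $ 2 = q $ 1 + q $ 2}"
  have "lines_through triangular_arrangement q = {?V, ?H, ?D}"
    unfolding triangular_lines_through using ints by auto
  moreover have "vector [q $ 1, q $ 2 + 1] \<in> ?V" "vector [q $ 1, q $ 2 + 1] \<notin> ?H"
    "vector [q $ 1, q $ 2 + 1] \<notin> ?D" "vector [q $ 1 + 1, q $ 2] \<in> ?H" "vector [q $ 1 + 1, q $ 2] \<notin> ?D"
    by simp_all
  then have "?V \<noteq> ?H" "?V \<noteq> ?D" "?H \<noteq> ?D"
    by metis+
  ultimately show ?thesis by simp
qed

lemma lines_through_image: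
  assumes "bij g"
  shows "lines_through ((\<lambda>l. g ` l) ` \<B>) (g q) = (\<lambda>l. g ` l) ` lines_through \<B> q"
proof -
  have "g q \<in> g ` l \<longleftrightarrow> q \<in> l" for l
    by (rule inj_image_mem_iff[OF bij_is_inj[OF assms]])
  then show ?thesis unfolding lines_through_def by blast
qed

lemma affinely_triangular_vertex:
  assumes "affinely_triangular \<A>" "is_vertex \<A> p"
  shows "card (lines_through \<A> p) = 3"
proof -
  obtain M d where A: "\<A> = (\<lambda>l. (\<lambda>x. M x + d) ` l) ` triangular_arrangement"
    and b: "bij (\<lambda>x. M x + d)"
    using affinely_triangularE[OF assms(1)] by metis
  define g where "g = (\<lambda>x. M x + d)"
  have A: "\<A> = (\<lambda>l. g ` l) ` triangular_arrangement" and b: "bij g"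
    using A b by (simp_all add: g_def)
  obtain q where q: "p = g q" using b by (metis bij_pointE)
  have through: "lines_through \<A> p = (\<lambda>l. g ` l) ` lines_through triangular_arrangement q"
    unfolding A q by (rule lines_through_image[OF b])
  obtain l m where "l \<in> lines_through \<A> p" "m \<in> lines_through \<A> p" "l \<noteq> m"
    using assms(2) unfolding is_vertex_def by auto
  then obtain l' m' where "l' \<in> lines_through triangular_arrangement q"
    "m' \<in> lines_through triangular_arrangement q" "g ` l' \<noteq> g ` m'"
    unfolding through by (elim imageE) simp
  then have "is_vertex triangular_arrangement q"
    unfolding is_vertex_def by (intro bexI[of _ l'] bexI[of _ m']) auto
  moreover have "card (lines_through \<A> p) = card (lines_through triangular_arrangement q)"
    unfolding through
    by (rule card_image) (use bij_is_inj[OF b] in \<open>auto simp: inj_on_def inj_image_eq_iff\<close>)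
  ultimately show ?thesis using triangular_vertex by simp
qed

text \<open>
  The two kinds of faces: with \<open>e = 1\<close> the lower half of the unit square whose lower left corner is
  \<open>(A, B)\<close>, with \<open>e = -1\<close> the upper half of the one whose upper right corner is \<open>(A, B)\<close>.
\<close>

definition cell :: "real \<Rightarrow> real \<Rightarrow> real \<Rightarrow> (real^2) set" where
  "cell A B e = {q. 0 < e * (q $ 1 - A) \<and> 0 < e * (q $ 2 - B) \<and> e * (q $ 1 + q $ 2 - A - B) < 1}"

lemma interior_standard_triangle:
  "interior (convex hull {0, axis 1 1, axis 2 1}) = cell 0 0 1"
proof -
  have B: "(Basis :: (real^2) set) = {axis 1 1, axis 2 1}"
    by (auto simp: Basis_vec_def UNIV_2)
  have "axis 1 (1::real) \<noteq> (axis 2 1 :: real^2)"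
    by (simp add: axis_eq_axis)
  then show ?thesis
    using interior_std_simplex[where 'a = "real^2"]
    unfolding B by (auto simp: cell_def inner_axis)
qed

lemma cell_image:
  assumes "e = 1 \<or> e = -1"
  shows "cell A B e = (\<lambda>x. e *\<^sub>R x + vector [A, B]) ` cell 0 0 1"
proof
  show "cell A B e \<subseteq> (\<lambda>x. e *\<^sub>R x + vector [A, B]) ` cell 0 0 1"
  proof
    fix q assume "q \<in> cell A B e"
    then have "e *\<^sub>R (q - vector [A, B]) \<in> cell 0 0 1"
      by (simp add: cell_def algebra_simps)
    moreover have "q = e *\<^sub>R (e *\<^sub>R (q - vector [A, B])) + vector [A, B]"
      using assms by auto
    ultimately show "q \<in> (\<lambda>x. e *\<^sub>R x + vector [A, B]) ` cell 0 0 1" by blast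
  qed
  show "(\<lambda>x. e *\<^sub>R x + vector [A, B]) ` cell 0 0 1 \<subseteq> cell A B e"
    using assms by (auto simp: cell_def)
qed

lemma open_triangle_image:
  assumes M: "linear M" "inj M" and e: "e = 1 \<or> e = -1"
  shows "open_triangle ((\<lambda>x. M x + d) ` cell A B e)"
proof -
  define K where "K = (\<lambda>x. e *\<^sub>R M x)"
  define b where "b = M (vector [A, B]) + d"
  have K: "linear K"
    unfolding K_def using M(1) by (simp add: linear_compose_scale_right)
  have injK: "inj K"
    using M(2) e by (auto simp: K_def inj_def)
  let ?S = "{0, axis 1 1, axis 2 1} :: (real^2) set"
  have "(\<lambda>x. M x + d) ` cell A B e = (\<lambda>x. b + x) ` (K ` interior (convex hull ?S))"
    unfolding cell_image[OF e] image_image interior_standard_triangle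
    by (simp add: linear_add[OF M(1)] linear_scale[OF M(1)] K_def b_def add_ac)
  also have "\<dots> = interior (convex hull ((\<lambda>x. b + x) ` K ` ?S))"
    by (simp only: interior_injective_linear_image[OF K injK, symmetric]
        convex_hull_linear_image[OF K, symmetric] interior_translation convex_hull_translation)
  also have "(\<lambda>x. b + x) ` K ` ?S = {b, b + K (axis 1 1), b + K (axis 2 1)}"
    by (simp add: linear_0[OF K])
  finally have F: "(\<lambda>x. M x + d) ` cell A B e = interior (convex hull {b, b + K (axis 1 1), b + K (axis 2 1)})" .
  have "\<not> collinear {b, b + K (axis 1 1), b + K (axis 2 1)}"
  proof
    assume "collinear {b, b + K (axis 1 1), b + K (axis 2 1)}"
    then obtain u where u: "\<And>x y. \<lbrakk>x \<in> {b, b + K (axis 1 1), b + K (axis 2 1)};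
        y \<in> {b, b + K (axis 1 1), b + K (axis 2 1)}\<rbrakk> \<Longrightarrow> \<exists>c. x - y = c *\<^sub>R u"
      unfolding collinear_def by blast
    obtain c1 where c1: "K (axis 1 1) = c1 *\<^sub>R u" using u[of "b + K (axis 1 1)" b] by auto
    obtain c2 where c2: "K (axis 2 1) = c2 *\<^sub>R u" using u[of "b + K (axis 2 1)" b] by auto
    \<comment> \<open>Both sides are \<open>c1 * c2\<close> times \<open>u\<close>. By injectivity
      the independent unit vectors force \<open>c1 = 0\<close>, so \<open>K\<close> would send a
      nonzero vector to 0.\<close>
    have "K (c2 *\<^sub>R axis 1 1) = K (c1 *\<^sub>R axis 2 1)"
      by (simp add: linear_scale[OF K] c1 c2)
    then have "c2 *\<^sub>R axis 1 1 = (c1 *\<^sub>R axis 2 1 :: real^2)"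
      using injK by (simp add: inj_eq)
    then have "c1 = 0"
      by (simp add: vec_eq_iff forall_2 axis_def)
    then have "K (axis 1 1) = K 0" using c1 linear_0[OF K] by simp
    then have "axis 1 1 = (0 :: real^2)" using injK by (simp only: inj_eq)
    then show False by (simp add: vec_eq_iff forall_2 axis_def)
  qed
  then show ?thesis unfolding open_triangle_def F by blast
qed

lemma no_int_between:
  assumes "x \<in> \<int>" "a \<in> \<int>" "e = 1 \<or> e = -1" "0 < e * (x - a)" "e * (x - a) < (1::real)"
  shows False
proof -
  have "e * (x - a) \<in> \<int>"
    using assms(1-3) by auto
  then show False using assms(4,5) Ints_nonzero_abs_less1 by force
qed

lemma triangular_complement:
  "q \<in> - \<Union>triangular_arrangement \<longleftrightarrow> q $ 1 \<notin> \<int> \<and> q $ 2 \<notin> \<int> \<and> q $ 1 + q $ 2 \<notin> \<int>"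
  by (auto simp: triangular_arrangement_def Ints_def)

text \<open>Two positive numbers with sum below 1 are each below 1, so all three offsets from the
  integer corner lie strictly between 0 and 1.\<close>

lemma cell_disjoint:
  assumes "A \<in> \<int>" "B \<in> \<int>" "e = 1 \<or> e = -1"
  shows "cell A B e \<subseteq> - \<Union>triangular_arrangement"
proof
  fix q assume "q \<in> cell A B e"
  then have q: "0 < e * (q $ 1 - A)" "0 < e * (q $ 2 - B)" "e * (q $ 1 + q $ 2 - (A + B)) < 1"
    by (simp_all add: cell_def algebra_simps)
  moreover have "e * (q $ 1 + q $ 2 - (A + B)) = e * (q $ 1 - A) + e * (q $ 2 - B)"
    by (simp add: algebra_simps)
  ultimately have "e * (q $ 1 - A) < 1" "e * (q $ 2 - B) < 1" "0 < e * (q $ 1 + q $ 2 - (A + B))"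
    by linarith+
  then show "q \<in> - \<Union>triangular_arrangement"
    unfolding triangular_complement using q assms no_int_between[of _ _ e] Ints_add by blast
qed

lemma cell_cover:
  assumes "q \<in> - \<Union>triangular_arrangement"
  obtains A B e where "A \<in> \<int>" "B \<in> \<int>" "e = 1 \<or> e = -1" "q \<in> cell A B e"
proof -
  define a b :: real where "a = of_int \<lfloor>q $ 1\<rfloor>" and "b = of_int \<lfloor>q $ 2\<rfloor>"
  have ab: "a \<in> \<int>" "b \<in> \<int>" by (simp_all add: a_def b_def)
  have q: "q $ 1 \<notin> \<int>" "q $ 2 \<notin> \<int>" "q $ 1 + q $ 2 \<notin> \<int>"
    using assms triangular_complement by blast+
  have "a \<le> q $ 1" "q $ 1 < a + 1" "b \<le> q $ 2" "q $ 2 < b + 1"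
    unfolding a_def b_def by linarith+
  moreover have "a \<noteq> q $ 1" "b \<noteq> q $ 2" "a + b + 1 \<noteq> q $ 1 + q $ 2"
    using q ab by (metis Ints_add Ints_1)+
  ultimately have lt: "a < q $ 1" "q $ 1 < a + 1" "b < q $ 2" "q $ 2 < b + 1"
    "a + b + 1 < q $ 1 + q $ 2 \<or> q $ 1 + q $ 2 < a + b + 1"
    by linarith+
  \<comment> \<open>The diagonal \<open>x + y = a + b + 1\<close> cuts the unit square at
    \<open>(a, b)\<close> into one cell of each kind.\<close>
  show ?thesis
    using lt(5)
  proof
    assume "q $ 1 + q $ 2 < a + b + 1"
    then have "q \<in> cell a b 1" using lt by (simp add: cell_def)
    then show ?thesis using that ab by blast
  next
    assume "a + b + 1 < q $ 1 + q $ 2"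
    then have "q \<in> cell (a + 1) (b + 1) (-1)" using lt by (simp add: cell_def)
    then show ?thesis using that[of "a + 1" "b + 1" "-1"] ab by simp
  qed
qed

lemma connected_stays_above:
  fixes a :: "real^2"
  assumes "connected S" "x \<in> S" "y \<in> S" "b < a \<bullet> x" "\<And>z. z \<in> S \<Longrightarrow> a \<bullet> z \<noteq> b"
  shows "b < a \<bullet> y"
  using connected_ivt_hyperplane[OF assms(1,3,2), of a b] assms(4,5) by fastforce

text \<open>The sides of a cell lie on lines of the arrangement, so a connected set avoiding these
  lines cannot leave it: the intermediate value theorem is applied along each of the three inward
  normals.\<close>

lemma connected_subset_cell:
  assumes "connected S" "S \<subseteq> - \<Union>triangular_arrangement" "x \<in> S"
    and "A \<in> \<int>" "B \<in> \<int>" "e = 1 \<or> e = -1" "x \<in> cell A B e"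
  shows "S \<subseteq> cell A B e"
proof
  fix y assume y: "y \<in> S"
  have inn: "vector [e, 0] \<bullet> q = e * q $ 1" "vector [0, e] \<bullet> q = e * q $ 2"
    "vector [-e, -e] \<bullet> q = - (e * (q $ 1 + q $ 2))" for q :: "real^2"
    by (simp_all add: inner_vec_def sum_2 algebra_simps)
  have e0: "e \<noteq> 0" using assms(6) by auto
  have nz: "q $ 1 \<noteq> A" "q $ 2 \<noteq> B" "e * (q $ 1 + q $ 2) \<noteq> e * (A + B) + 1" if "q \<in> S" for q
  proof -
    have q: "q $ 1 \<notin> \<int>" "q $ 2 \<notin> \<int>" "q $ 1 + q $ 2 \<notin> \<int>"
      using that assms(2) triangular_complement by blast+
    show "q $ 1 \<noteq> A" "q $ 2 \<noteq> B" using q assms by auto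
    have "q $ 1 + q $ 2 \<noteq> A + B + e"
      using q(3) assms(4-6) by auto
    then show "e * (q $ 1 + q $ 2) \<noteq> e * (A + B) + 1"
      using assms(6) by auto
  qed
  have x: "e * A < e * x $ 1" "e * B < e * x $ 2" "e * (x $ 1 + x $ 2) < e * (A + B) + 1"
    using assms(7) by (simp_all add: cell_def algebra_simps)
  have "e * A < vector [e, 0] \<bullet> y"
    by (rule connected_stays_above[OF assms(1,3) y]) (use x nz e0 in \<open>auto simp: inn\<close>)
  moreover have "e * B < vector [0, e] \<bullet> y"
    by (rule connected_stays_above[OF assms(1,3) y]) (use x nz e0 in \<open>auto simp: inn\<close>)
  moreover have "- (e * (A + B) + 1) < vector [-e, -e] \<bullet> y"
    by (rule connected_stays_above[OF assms(1,3) y]) (use x nz e0 in \<open>auto simp only: inn neg_equal_iff_equal neg_less_iff_less\<close>)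
  ultimately show "y \<in> cell A B e"
    by (simp add: inn cell_def algebra_simps)
qed

lemma connected_cell:
  assumes "e = 1 \<or> e = -1"
  shows "connected (cell A B e)"
proof -
  have "connected (cell 0 0 1)"
    unfolding interior_standard_triangle[symmetric] by (intro convex_connected convex_interior) simp
  then show ?thesis
    unfolding cell_image[OF assms] by (intro connected_continuous_image continuous_intros)
qed

text \<open>Pulled back by \<open>f\<close>, a face is connected and misses the lines, so it stays
  in one cell. The image of that cell is connected and misses \<open>\<A>\<close>, so maximality of
  the component gives equality.\<close>

lemma affinely_triangular_face:
  assumes "affinely_triangular \<A>" "F \<in> arrangement_faces \<A>"
  shows "open_triangle F"
proof -
  obtain M d where M: "linear M" "inj M" and A: "\<A> = (\<lambda>l. (\<lambda>x. M x + d) ` l) ` triangular_arrangement"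
    and b: "bij (\<lambda>x. M x + d)"
    using affinely_triangularE[OF assms(1)] by metis
  define g where "g = (\<lambda>x. M x + d)"
  have A: "\<A> = (\<lambda>l. g ` l) ` triangular_arrangement" and b: "bij g"
    using A b by (simp_all add: g_def)
  have cg: "continuous_on S g" for S
    unfolding g_def using M(1) by (intro continuous_intros linear_continuous_on) (simp add: linear_conv_bounded_linear)
  obtain M' where M': "linear M'" "\<And>x. M' (M x) = x" "\<And>x. M (M' x) = x"
    using linear_injective_isomorphism[OF M] by blast
  define f where "f = (\<lambda>x. M' x - M' d)"
  have gf: "g (f x) = x" and fg: "f (g x) = x" for x
    by (simp_all add: f_def g_def M' linear_add[OF M'(1)] linear_diff[OF M(1)])
  have cf: "continuous_on S f" for S
    unfolding f_def using M'(1) by (intro continuous_intros linear_continuous_on) (simp add: linear_conv_bounded_linear)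
  have compl: "- \<Union>\<A> = g ` (- \<Union>triangular_arrangement)"
    unfolding A image_Union[symmetric] by (rule bij_image_Compl_eq[OF b, symmetric])
  have F: "F \<in> components (- \<Union>\<A>)"
    using assms(2) by (simp add: arrangement_faces_def)
  have conn: "connected F" and sub: "F \<subseteq> - \<Union>\<A>" and ne: "F \<noteq> {}"
    using F in_components_connected in_components_subset in_components_nonempty by blast+
  obtain x where x: "x \<in> F" using ne by blast
  have fF: "f ` F \<subseteq> - \<Union>triangular_arrangement"
    using sub fg unfolding compl by auto
  obtain p q e where c: "p \<in> \<int>" "q \<in> \<int>" "e = 1 \<or> e = -1" "f x \<in> cell p q e"
    using cell_cover fF x by blast
  have "f ` F \<subseteq> cell p q e"
    by (rule connected_subset_cell[OF connected_continuous_image[OF cf conn] fF _ c]) (use x in simp)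
  then have 1: "F \<subseteq> g ` cell p q e"
    using gf by (metis image_eqI image_subset_iff subsetI)
  have "g ` cell p q e \<subseteq> F"
  proof (rule components_maximal[OF F])
    show "connected (g ` cell p q e)"
      by (rule connected_continuous_image[OF cg connected_cell[OF c(3)]])
    show "g ` cell p q e \<subseteq> - \<Union>\<A>"
      unfolding compl using cell_disjoint[OF c(1-3)] by blast
    show "F \<inter> g ` cell p q e \<noteq> {}" using 1 x by blast
  qed
  with 1 have "F = g ` cell p q e" by blast
  then show ?thesis
    using open_triangle_image[OF M c(3)] by (simp add: g_def)
qed

section \<open>Mutual exclusion of the three cases, and the converse\<close>

lemma triangular_not_concurrent:
  assumes "affinely_triangular \<A>"
  shows "\<not> concurrent \<A>"
proof
  assume "concurrent \<A>"
  then obtain p where p: "\<And>l. l \<in> \<A> \<Longrightarrow> p \<in> l" by (auto simp: concurrent_def)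
  obtain f where "(\<lambda>l. f ` l) ` \<A> = triangular_arrangement"
    using assms by (auto simp: affinely_triangular_def)
  then have "f p \<in> l" if "l \<in> triangular_arrangement" for l
    using p that by blast
  moreover have "{p. p $ 1 = of_int 0} \<in> triangular_arrangement" "{p. p $ 1 = of_int 1} \<in> triangular_arrangement"
    unfolding triangular_arrangement_def by blast+
  ultimately have "f p \<in> {p. p $ 1 = of_int 0}" "f p \<in> {p. p $ 1 = of_int 1}"
    by blast+
  then show False by simp
qed

lemma triangular_not_parallel:
  assumes "affinely_triangular \<A>"
  shows "\<not> all_parallel \<A>"
proof
  assume par: "all_parallel \<A>"
  obtain f L c where L: "linear L" and f: "f = (\<lambda>x. L x + c)"
    and eq: "(\<lambda>l. f ` l) ` \<A> = triangular_arrangement"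
    using assms by (auto simp: affinely_triangular_def affine_map_def)
  let ?V = "{p::real^2. p $ 1 = of_int 0}" and ?H = "{p::real^2. p $ 2 = of_int 0}"
  have "?V \<in> triangular_arrangement" "?H \<in> triangular_arrangement"
    unfolding triangular_arrangement_def by blast+
  then obtain l m where lm: "l \<in> \<A>" "m \<in> \<A>" "f ` l = ?V" "f ` m = ?H"
    unfolding eq[symmetric] by auto
  then obtain a where a: "m = (+) a ` l"
    using par unfolding all_parallel_def affine_parallel_def by blast
  \<comment> \<open>The line \<open>x = 0\<close> shifted by \<open>L a\<close> would lie in
    \<open>y = 0\<close>; two of its points with different second coordinates refute this.\<close>
  have "L a + q \<in> ?H" if "q \<in> ?V" for q
  proof -
    obtain x where x: "x \<in> l" "q = f x" using \<open>q \<in> ?V\<close> lm(3) by blast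
    have "f (a + x) \<in> ?H" using a x(1) lm(4) by blast
    then show ?thesis by (simp add: x(2) f linear_add[OF L] add_ac)
  qed
  from this[of "vector [0, 0]"] this[of "vector [0, 1]"] show False by simp
qed

lemma vertex_not_parallel:
  assumes "\<forall>l\<in>\<A>. is_line l" "is_vertex \<A> p"
  shows "\<not> all_parallel \<A>"
  using assms affine_parallel_meet_eq[of _ _ p]
  unfolding is_vertex_def lines_through_def all_parallel_def by blast

text \<open>Two crossing lines are concurrent and meet in an ordinary vertex, hence the condition on
  \<open>card\<close>. In general the only possible vertex is the common point, which lies on every
  line.\<close>

lemma concurrent_not_ordinary:
  assumes "\<forall>l\<in>\<A>. is_line l" "concurrent \<A>" "card \<A> \<noteq> 2"
  shows "\<not> ordinary_vertex \<A> p"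
proof
  assume ord: "ordinary_vertex \<A> p"
  obtain c where c: "\<And>l. l \<in> \<A> \<Longrightarrow> c \<in> l" using assms(2) by (auto simp: concurrent_def)
  have "\<exists>l\<in>lines_through \<A> p. \<exists>m\<in>lines_through \<A> p. l \<noteq> m"
    using ord by (simp add: ordinary_vertex_def is_vertex_def)
  then obtain l m where lm: "l \<in> \<A>" "m \<in> \<A>" "l \<noteq> m" "p \<in> l" "p \<in> m"
    by (auto simp: lines_through_def)
  then have "p = c"
    using is_line_eqI[of l m p c] assms(1) c by blast
  then have "lines_through \<A> p = \<A>"
    using c by (auto simp: lines_through_def)
  then show False using ord assms(3) by (simp add: ordinary_vertex_def)
qed

theorem theorem8:
  fixes \<A> :: "(real^2) set set"
  assumes lines: "\<forall>l\<in>\<A>. is_line l"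
    and locally_finite: "locally_finite_lines \<A>"
    and at_least_two: "\<exists>l\<in>\<A>. \<exists>m\<in>\<A>. l \<noteq> m"
  shows
    "((\<nexists>p. ordinary_vertex \<A> p) \<longrightarrow>
        (all_parallel \<A> \<and> \<not> concurrent \<A> \<and> \<not> affinely_triangular \<A>) \<or>
        (\<not> all_parallel \<A> \<and> concurrent \<A> \<and> \<not> affinely_triangular \<A>) \<or>
        (\<not> all_parallel \<A> \<and> \<not> concurrent \<A> \<and> affinely_triangular \<A>)) \<and>
     (all_parallel \<A> \<longrightarrow> (\<nexists>p. ordinary_vertex \<A> p)) \<and>
     (concurrent \<A> \<and> card \<A> \<noteq> 2 \<longrightarrow> (\<nexists>p. ordinary_vertex \<A> p)) \<and>
     (affinely_triangular \<A> \<longrightarrow> (\<nexists>p. ordinary_vertex \<A> p)) \<and>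
     (affinely_triangular \<A> \<longrightarrow>
        (\<forall>p. is_vertex \<A> p \<longrightarrow> card (lines_through \<A> p) = 3) \<and>
        (\<forall>F\<in>arrangement_faces \<A>. open_triangle F))"
proof (intro conjI)
  have "\<not> (all_parallel \<A> \<and> concurrent \<A>)"
  proof
    assume pc: "all_parallel \<A> \<and> concurrent \<A>"
    then obtain c where "\<And>l. l \<in> \<A> \<Longrightarrow> c \<in> l" by (auto simp: concurrent_def)
    then have "is_vertex \<A> c"
      using at_least_two by (auto simp: is_vertex_def lines_through_def)
    then show False using vertex_not_parallel lines pc by blast
  qed
  moreover have "affinely_triangular \<A>"
    if "\<nexists>p. ordinary_vertex \<A> p" "\<not> all_parallel \<A>" "\<not> concurrent \<A>"
  proof -
    interpret arrangement \<A>
      using lines locally_finite that(1) by unfold_locales auto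
    show ?thesis by (rule affinely_triangular_of_nonparallel_nonconcurrent[OF that(2,3)])
  qed
  ultimately show "(\<nexists>p. ordinary_vertex \<A> p) \<longrightarrow>
        (all_parallel \<A> \<and> \<not> concurrent \<A> \<and> \<not> affinely_triangular \<A>) \<or>
        (\<not> all_parallel \<A> \<and> concurrent \<A> \<and> \<not> affinely_triangular \<A>) \<or>
        (\<not> all_parallel \<A> \<and> \<not> concurrent \<A> \<and> affinely_triangular \<A>)"
    using triangular_not_parallel triangular_not_concurrent by blast
  show "all_parallel \<A> \<longrightarrow> (\<nexists>p. ordinary_vertex \<A> p)"
    using vertex_not_parallel lines by (auto simp: ordinary_vertex_def)
  show "concurrent \<A> \<and> card \<A> \<noteq> 2 \<longrightarrow> (\<nexists>p. ordinary_vertex \<A> p)"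
    using concurrent_not_ordinary lines by blast
  show "affinely_triangular \<A> \<longrightarrow> (\<nexists>p. ordinary_vertex \<A> p)"
    using affinely_triangular_vertex by (fastforce simp: ordinary_vertex_def)
  show "affinely_triangular \<A> \<longrightarrow>
        (\<forall>p. is_vertex \<A> p \<longrightarrow> card (lines_through \<A> p) = 3) \<and>
        (\<forall>F\<in>arrangement_faces \<A>. open_triangle F)"
    using affinely_triangular_vertex affinely_triangular_face by blast
qed

end
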